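(* Let $K:L^1(\mathbb{R}^2)\to L^1(\mathbb{R}^2)$ be a positive bounded linear operator with $\int_{\mathbb{R}^2}Ku=\int_{\mathbb{R}^2}u$ for all $u\in L^1(\mathbb{R}^2)$, let $\lambda\ge0$, $u_0\in BV(\mathbb{R}^2)$, and $f:=Ku_0$. Then $u_0$ is a minimizer of $F_3$ over $BV(\mathbb{R}^2)$ if and only if there exists $v\in\mathcal{V}(u_0)$ such that for all $w\in BV(\mathbb{R}^2)$ $$\Big|\int_{\mathbb{R}^2}w\,\mathrm{div}\,v\Big|\le\lambda\int_{\mathbb{R}^2}|Kw|.\qquad(\ast)$$ Moreover, if such a $v$ exists and the inequality $(\ast)$ is strict for every $w\in BV(\mathbb{R}^2)$ with $w\ne0$, then $u_0$ is the unique minimizer of $F_3$ over $BV(\mathbb{R}^2)$.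
   Context: For $u\in L^1_{loc}(\mathbb{R}^2)$ the anisotropic total variation is $\int_{\mathbb{R}^2}|u_x|+|u_y|:=\sup\{\int_{\mathbb{R}^2}u\,\mathrm{div}\,v : v\in C^1_c(\mathbb{R}^2;\mathbb{R}^2),\ |v(x)|_\infty\le 1\ \forall x\}$, where $|(a,b)|_\infty=\max(|a|,|b|)$. $BV(\mathbb{R}^2)$ is the space of $u\in L^1(\mathbb{R}^2)$ with finite (isotropic) total variation. For $u\in BV(\mathbb{R}^2)$, $\mathcal{V}(u)$ is the set of $v\in L^\infty(\mathbb{R}^2;\mathbb{R}^2)$ such that (1) $|v(x)|_\infty\le1$ a.e.; (2) the distributional divergence $\mathrm{div}\,v$ belongs to $L^\infty(\mathbb{R}^2)$; (3) $-\int_{\mathbb{R}^2}u\,\mathrm{div}\,v=\int_{\mathbb{R}^2}|u_x|+|u_y|$. $F_3(u)=\int_{\mathbb{R}^2}|u_x|+|u_y|+\lambda\|Ku-f\|_{L^1(\mathbb{R}^2)}$ for $u\in BV(\mathbb{R}^2)$. *)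

theory Defs
  imports "HOL-Analysis.Analysis"
begin

type_synonym pt = "real \<times> real"

definition px :: "(pt \<Rightarrow> real) \<Rightarrow> pt \<Rightarrow> real" where
  "px f p = deriv (\<lambda>t. f (t, snd p)) (fst p)"

definition py :: "(pt \<Rightarrow> real) \<Rightarrow> pt \<Rightarrow> real" where
  "py f p = deriv (\<lambda>t. f (fst p, t)) (snd p)"

definition C1c :: "(pt \<Rightarrow> real) \<Rightarrow> bool" where
  "C1c f \<longleftrightarrow> (\<forall>p. f differentiable (at p)) \<and> continuous_on UNIV (px f)
      \<and> continuous_on UNIV (py f) \<and> compact (closure {p. f p \<noteq> 0})"

definition TV_aniso :: "(pt \<Rightarrow> real) \<Rightarrow> ereal" where
  "TV_aniso u = (SUP v \<in> {(v1, v2). C1c v1 \<and> C1c v2 \<and> (\<forall>p. \<bar>v1 p\<bar> \<le> 1 \<and> \<bar>v2 p\<bar> \<le> 1)}.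
      ereal (\<integral>p. u p * (px (fst v) p + py (snd v) p) \<partial>lborel))"

definition TV_iso :: "(pt \<Rightarrow> real) \<Rightarrow> ereal" where
  "TV_iso u = (SUP v \<in> {(v1, v2). C1c v1 \<and> C1c v2 \<and> (\<forall>p. (v1 p)\<^sup>2 + (v2 p)\<^sup>2 \<le> 1)}.
      ereal (\<integral>p. u p * (px (fst v) p + py (snd v) p) \<partial>lborel))"

definition BV :: "(pt \<Rightarrow> real) \<Rightarrow> bool" where
  "BV u \<longleftrightarrow> integrable lborel u \<and> TV_iso u < \<infinity>"

definition Linf :: "(pt \<Rightarrow> real) \<Rightarrow> bool" where
  "Linf g \<longleftrightarrow> g \<in> borel_measurable lborel \<and> (\<exists>C. AE p in lborel. \<bar>g p\<bar> \<le> C)"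

definition distr_div :: "(pt \<Rightarrow> real) \<Rightarrow> (pt \<Rightarrow> real) \<Rightarrow> (pt \<Rightarrow> real) \<Rightarrow> bool" where
  "distr_div v1 v2 g \<longleftrightarrow> (\<forall>\<phi>. C1c \<phi> \<longrightarrow>
      (\<integral>p. v1 p * px \<phi> p + v2 p * py \<phi> p \<partial>lborel) = - (\<integral>p. g p * \<phi> p \<partial>lborel))"

definition inV :: "(pt \<Rightarrow> real) \<Rightarrow> (pt \<Rightarrow> real) \<Rightarrow> (pt \<Rightarrow> real) \<Rightarrow> (pt \<Rightarrow> real) \<Rightarrow> bool" where
  "inV u v1 v2 g \<longleftrightarrow> Linf v1 \<and> Linf v2
      \<and> (AE p in lborel. \<bar>v1 p\<bar> \<le> 1 \<and> \<bar>v2 p\<bar> \<le> 1)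
      \<and> Linf g \<and> distr_div v1 v2 g
      \<and> ereal (- (\<integral>p. u p * g p \<partial>lborel)) = TV_aniso u"

definition F3 :: "real \<Rightarrow> ((pt \<Rightarrow> real) \<Rightarrow> (pt \<Rightarrow> real)) \<Rightarrow> (pt \<Rightarrow> real) \<Rightarrow> (pt \<Rightarrow> real) \<Rightarrow> ereal" where
  "F3 lam K f u = TV_aniso u + ereal (lam * (\<integral>p. \<bar>K u p - f p\<bar> \<partial>lborel))"

definition is_minimizer_F3 where
  "is_minimizer_F3 lam K f u0 \<longleftrightarrow> BV u0 \<and> (\<forall>u. BV u \<longrightarrow> F3 lam K f u0 \<le> F3 lam K f u)"

definition is_unique_minimizer_F3 where
  "is_unique_minimizer_F3 lam K f u0 \<longleftrightarrow> is_minimizer_F3 lam K f u0 \<and>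
     (\<forall>u. is_minimizer_F3 lam K f u \<longrightarrow> (AE p in lborel. u p = u0 p))"

end

theory Submission
  imports Defs
begin

text \<open>
  A certificate \<open>v\<close> bounds \<open>F\<^sub>3\<close> from below because \<open>- \<integral> u div v \<le> TV(u)\<close> for every integrable
  \<open>u\<close>: mollify \<open>v\<close>, cut it off, and pass to the limit, the mollified divergences being bounded
  and weakly-* convergent.

  Conversely, \<open>(v\<^sub>1, v\<^sub>2, div v)\<close> is sought as one linear functional on \<open>L\<^sup>1 \<times> L\<^sup>1 \<times> L\<^sup>1\<close> below the
  sublinear \<open>(a, b, c) \<mapsto> \<parallel>a\<parallel> + \<parallel>b\<parallel> + \<lambda> \<parallel>K c\<parallel>\<close>, prescribed to be \<open>- t TV(u\<^sub>0)\<close> at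
  \<open>(\<partial>\<^sub>x\<phi>, \<partial>\<^sub>y\<phi>, \<phi> + t u\<^sub>0)\<close> for test functions \<open>\<phi>\<close>. Compatibility of the prescription with the bound
  is minimality of \<open>u\<^sub>0\<close> against \<open>- \<phi> / t\<close>, so \<open>u\<^sub>0\<close> itself never has to be approximated by smooth
  functions. Hahn--Banach and the duality of \<open>L\<^sup>1\<close> and \<open>L\<^sup>\<infinity>\<close> give \<open>v\<close>.
\<close>

section \<open>Hahn--Banach\<close>


text \<open>Each slot of the functional delivers one requirement on \<open>v\<close>. The two plain
  norms force |v|_inf \<le> 1. The third bound is the inequality demanded of div v and, since
  \<open>K\<close> is bounded, it also puts the third component into L^inf. At t = 0 the
  prescription is the distributional identity, so the third component is div v; at \<phi> = 0 and t
  = 1 it says that the pairing with \<open>u0\<close> attains the total variation. Treating the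
  divergence as an unknown of its own avoids dualising the unbounded gradient operator. Hahn-Banach
  is used in the Mazur-Orlicz form, with point-value pairs forming a cone. A functional dominating
  the prescribed values is then obtained without first checking that the value depends only on the
  point. As the cone is symmetric, domination becomes equality. In the other direction, mollifying
  \<open>v\<close> does not make it compactly supported, and the cutoff adds a term to the
  divergence. That term is harmless because it is uniformly small while \<open>u\<close> is
  integrable.\<close>

definition sublinear :: "('a::real_vector \<Rightarrow> real) \<Rightarrow> bool" where
  "sublinear p \<longleftrightarrow> (\<forall>x y. p (x + y) \<le> p x + p y) \<and> (\<forall>c x. 0 \<le> c \<longrightarrow> p (c *\<^sub>R x) = c * p x)"

text \<open>Applying \<open>scale\<close> with factor \<open>1 / c\<close> at the point
  \<open>c *\<^sub>R x\<close> gives the reverse inequality, so homogeneity has to be checked on one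
  side and for positive factors only.\<close>

lemma sublinearI:
  assumes add: "\<And>x y. p (x + y) \<le> p x + p y"
    and scale: "\<And>c x. 0 < c \<Longrightarrow> p (c *\<^sub>R x) \<le> c * p x"
    and zero: "p 0 = 0"
  shows "sublinear p"
  unfolding sublinear_def
proof (intro conjI allI impI add)
  fix c :: real and x assume "0 \<le> c"
  show "p (c *\<^sub>R x) = c * p x"
  proof (cases "c = 0")
    case True
    then show ?thesis by (simp add: zero)
  next
    case False
    with \<open>0 \<le> c\<close> have c: "0 < c" by simp
    have "p ((1 / c) *\<^sub>R (c *\<^sub>R x)) \<le> (1 / c) * p (c *\<^sub>R x)"
      using c by (intro scale) simp
    then have "c * p x \<le> p (c *\<^sub>R x)"
      using c by (simp add: field_simps)
    with scale[OF c, of x] show ?thesis by simp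
  qed
qed

lemma sublinear_add: "sublinear p \<Longrightarrow> p (x + y) \<le> p x + p y"
  by (simp add: sublinear_def)

lemma sublinear_scale: "sublinear p \<Longrightarrow> 0 \<le> c \<Longrightarrow> p (c *\<^sub>R x) = c * p x"
  by (simp add: sublinear_def)

lemma sublinear_zero: "sublinear p \<Longrightarrow> p 0 = 0"
  using sublinear_scale[of p 0 0] by simp

lemma sublinear_ge_neg: "sublinear p \<Longrightarrow> - p (- x) \<le> p x"
  using sublinear_add[of p x "- x"] sublinear_zero[of p] by simp

lemma sublinear_diff: "sublinear p \<Longrightarrow> p m - p (- x) \<le> p (x + m)"
  using sublinear_add[of p "x + m" "- x"] by simp

text \<open>The infimum of \<open>p (x + m) - c\<close> over the cone is the auxiliary functional of
  Mazur and Orlicz. The conclusion is phrased at \<open>- m\<close> because an upper bound there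
  becomes the lower bound \<open>c\<close> at \<open>m\<close> for every linear functional below
  \<open>q\<close>.\<close>

lemma sublinear_below_on_cone:
  fixes p :: "'a::real_vector \<Rightarrow> real" and C :: "('a \<times> real) set"
  assumes p: "sublinear p"
    and C0: "0 \<in> C"
    and Cadd: "\<And>a b. a \<in> C \<Longrightarrow> b \<in> C \<Longrightarrow> a + b \<in> C"
    and Cscale: "\<And>t a. 0 \<le> t \<Longrightarrow> a \<in> C \<Longrightarrow> t *\<^sub>R a \<in> C"
    and Cp: "\<And>m c. (m, c) \<in> C \<Longrightarrow> c \<le> p m"
  shows "\<exists>q. sublinear q \<and> (\<forall>x. q x \<le> p x) \<and> (\<forall>m c. (m, c) \<in> C \<longrightarrow> q (- m) \<le> - c)"
proof -
  define q where "q x = (INF a\<in>C. p (x + fst a) - snd a)" for x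
  \<comment> \<open>This makes the infimum finite: \<open>p (x + m)\<close> is at least
    \<open>p m - p (- x)\<close>, and \<open>p m\<close> is at least \<open>c\<close> on the
    cone.\<close>
  have lb: "- p (- x) \<le> p (x + fst a) - snd a" if "a \<in> C" for x a
    using Cp[of "fst a" "snd a"] that sublinear_diff[OF p, of "fst a" x] by simp
  have bdd: "bdd_below ((\<lambda>a. p (x + fst a) - snd a) ` C)" for x
    by (rule bdd_belowI2) (rule lb)
  have upper: "q x \<le> p (x + fst a) - snd a" if "a \<in> C" for x a
    unfolding q_def using bdd that by (rule cINF_lower)
  have greatest: "z \<le> q x" if "\<And>a. a \<in> C \<Longrightarrow> z \<le> p (x + fst a) - snd a" for x z
    unfolding q_def using C0 that by (intro cINF_greatest) auto
  have neg: "q (- m) \<le> - c" if "(m, c) \<in> C" for m c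
    using upper[OF that, of "- m"] sublinear_zero[OF p] by simp
  have "sublinear q"
  proof (rule sublinearI)
    fix x y
    \<comment> \<open>The cone element \<open>a + b\<close> competes in the infimum at
      \<open>x + y\<close>; afterwards the infimum is taken over \<open>b\<close> and then over
      \<open>a\<close>.\<close>
    have *: "q (x + y) \<le> (p (x + fst a) - snd a) + (p (y + fst b) - snd b)"
      if "a \<in> C" "b \<in> C" for a b
      using upper[OF Cadd[OF that], of "x + y"] sublinear_add[OF p, of "x + fst a" "y + fst b"]
      by (simp add: algebra_simps)
    have "q (x + y) - (p (x + fst a) - snd a) \<le> q y" if "a \<in> C" for a
      using *[OF that] by (intro greatest) (simp add: algebra_simps)
    then have "q (x + y) - q y \<le> q x"
      by (intro greatest) (simp add: algebra_simps)
    then show "q (x + y) \<le> q x + q y" by simp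
  next
    fix c :: real and x assume c: "0 < c"
    have "q (c *\<^sub>R x) / c \<le> q x"
    proof (rule greatest)
      fix a assume a: "a \<in> C"
      have "q (c *\<^sub>R x) \<le> p (c *\<^sub>R x + fst (c *\<^sub>R a)) - snd (c *\<^sub>R a)"
        using c a by (intro upper Cscale) auto
      also have "\<dots> = c * (p (x + fst a) - snd a)"
        using sublinear_scale[OF p, of c "x + fst a"] c by (simp add: algebra_simps)
      finally show "q (c *\<^sub>R x) / c \<le> p (x + fst a) - snd a"
        using c by (simp add: field_simps)
    qed
    then show "q (c *\<^sub>R x) \<le> c * q x"
      using c by (simp add: field_simps)
  next
    have "0 \<le> q 0"
      using Cp by (intro greatest) (simp add: case_prod_beta)
    moreover have "q 0 \<le> 0"
      using neg[of 0 0] C0 by (simp add: zero_prod_def)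
    ultimately show "q 0 = 0" by simp
  qed
  moreover have "q x \<le> p x" for x
    using upper[OF C0, of x] by simp
  ultimately show ?thesis
    using neg by blast
qed

text \<open>Zorn's lemma yields a minimal sublinear functional below \<open>p\<close>. Minimality
  makes it odd, and an odd sublinear functional is additive and homogeneous for all real
  factors.\<close>

lemma sublinear_dominates_linear:
  fixes p :: "'a::real_vector \<Rightarrow> real"
  assumes p: "sublinear p"
  shows "\<exists>L. linear L \<and> (\<forall>x. L x \<le> p x)"
proof -
  define A where "A = {q. sublinear q \<and> (\<forall>x. q x \<le> p x)}"
  \<comment> \<open>The order is reversed because \<open>predicate_Zorn\<close> produces maximal
    elements and a minimal one is wanted.\<close>
  define ge :: "('a \<Rightarrow> real) \<Rightarrow> ('a \<Rightarrow> real) \<Rightarrow> bool" where "ge = (\<lambda>q r. r \<le> q)"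
  have "\<exists>m\<in>A. \<forall>a\<in>A. ge m a \<longrightarrow> a = m"
  proof (rule predicate_Zorn)
    show "partial_order_on A (relation_of ge A)"
      by (rule partial_order_on_relation_ofI) (auto simp: ge_def)
  next
    fix C assume "C \<in> Chains (relation_of ge A)"
    then have CA: "\<And>q. q \<in> C \<Longrightarrow> q \<in> A" and chain: "\<And>q r. q \<in> C \<Longrightarrow> r \<in> C \<Longrightarrow> q \<le> r \<or> r \<le> q"
      by (auto simp: Chains_def relation_of_def ge_def)
    show "\<exists>u\<in>A. \<forall>a\<in>C. ge a u"
    proof (cases "C = {}")
      case True
      then show ?thesis using p by (auto simp: A_def)
    next
      case False
      define u where "u x = (INF q\<in>C. q x)" for x
      have sub: "sublinear q" and le: "q x \<le> p x" if "q \<in> C" for q x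
        using CA[OF that] by (auto simp: A_def)
      have "- p (- x) \<le> q x" if "q \<in> C" for x q
        using sublinear_ge_neg[OF sub[OF that], of x] le[OF that, of "- x"] by linarith
      then have bdd: "bdd_below ((\<lambda>q. q x) ` C)" for x
        by (rule bdd_belowI2)
      have upper: "u x \<le> q x" if "q \<in> C" for x q
        unfolding u_def using bdd that by (rule cINF_lower)
      have greatest: "z \<le> u x" if "\<And>q. q \<in> C \<Longrightarrow> z \<le> q x" for x z
        unfolding u_def using False that by (intro cINF_greatest) auto
      have "sublinear u"
      proof (rule sublinearI)
        fix x y
        \<comment> \<open>In a chain the smaller of \<open>q\<close> and \<open>r\<close> can serve
          at both points; this is where the pointwise infimum stays subadditive.\<close>
        have *: "u (x + y) \<le> q x + r y" if qr: "q \<in> C" "r \<in> C" for q r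
        proof -
          obtain s where s: "s \<in> C" "s \<le> q" "s \<le> r"
            using chain[OF qr] qr by blast
          have "u (x + y) \<le> s x + s y"
            using upper[OF s(1)] sublinear_add[OF sub[OF s(1)]] order_trans by blast
          also have "\<dots> \<le> q x + r y"
            using s(2,3) by (intro add_mono) (auto simp: le_fun_def)
          finally show ?thesis .
        qed
        have "u (x + y) - q x \<le> u y" if "q \<in> C" for q
          using *[OF that] by (intro greatest) (simp add: algebra_simps)
        then have "u (x + y) - u y \<le> u x"
          by (intro greatest) (simp add: algebra_simps)
        then show "u (x + y) \<le> u x + u y" by simp
      next
        fix c :: real and x assume c: "0 < c"
        have "u (c *\<^sub>R x) / c \<le> u x"
        proof (rule greatest)
          fix q assume q: "q \<in> C"
          then show "u (c *\<^sub>R x) / c \<le> q x"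
            using upper[OF q, of "c *\<^sub>R x"] sublinear_scale[OF sub[OF q], of c x] c
            by (simp add: field_simps)
        qed
        then show "u (c *\<^sub>R x) \<le> c * u x"
          using c by (simp add: field_simps)
      next
        show "u 0 = 0"
          unfolding u_def using False sub by (simp add: sublinear_zero)
      qed
      moreover have "u x \<le> p x" for x
        using False upper le by (meson ex_in_conv order_trans)
      ultimately show ?thesis
        using upper by (auto simp: A_def ge_def le_fun_def)
    qed
  qed
  then obtain q where qA: "q \<in> A" and min: "\<And>r. r \<in> A \<Longrightarrow> r \<le> q \<Longrightarrow> r = q"
    by (auto simp: ge_def)
  have q: "sublinear q" and qp: "\<And>x. q x \<le> p x"
    using qA by (auto simp: A_def)
  have odd: "q (- y) = - q y" for y
  proof -
    \<comment> \<open>Forcing the value \<open>- q y\<close> at \<open>- y\<close> yields a smaller sublinear functional, hence \<open>q\<close> itself.\<close>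
    define C where "C = (\<lambda>t. (t *\<^sub>R y, t * q y)) ` {0..}"
    have "\<exists>r. sublinear r \<and> (\<forall>x. r x \<le> q x) \<and> (\<forall>m c. (m, c) \<in> C \<longrightarrow> r (- m) \<le> - c)"
    proof (rule sublinear_below_on_cone[OF q])
      show "0 \<in> C" unfolding C_def by (rule image_eqI[of _ _ 0]) (auto simp: zero_prod_def)
      show "a + b \<in> C" if "a \<in> C" "b \<in> C" for a b
        using that unfolding C_def
        by (auto simp: scaleR_left_distrib[symmetric] distrib_right[symmetric])
      show "t *\<^sub>R a \<in> C" if "0 \<le> t" "a \<in> C" for t a
        using that unfolding C_def by (force simp: mult.assoc[symmetric])
      show "c \<le> q m" if "(m, c) \<in> C" for m c
        using that unfolding C_def by (auto simp: sublinear_scale[OF q])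
    qed
    then obtain r where r: "sublinear r" "\<And>x. r x \<le> q x" "\<And>m c. (m, c) \<in> C \<Longrightarrow> r (- m) \<le> - c"
      by blast
    have "r = q"
      using r qp order_trans by (intro min) (auto simp: A_def le_fun_def, blast)
    moreover have "(y, q y) \<in> C"
      unfolding C_def by (rule image_eqI[of _ _ 1]) auto
    ultimately have "q (- y) \<le> - q y"
      using r(3) by blast
    with sublinear_ge_neg[OF q, of "y"] show ?thesis by simp
  qed
  have "linear q"
  proof (rule linearI)
    fix x y
    \<comment> \<open>Subadditivity at the negatives is superadditivity at \<open>x\<close> and
      \<open>y\<close>, by oddness.\<close>
    have "q (- x + - y) \<le> q (- x) + q (- y)"
      by (rule sublinear_add[OF q])
    then have "- q (x + y) \<le> - q x - q y"
      using odd[of "x + y"] by (simp add: odd add.commute)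
    with sublinear_add[OF q, of x y] show "q (x + y) = q x + q y" by simp
  next
    fix c :: real and x
    show "q (c *\<^sub>R x) = c *\<^sub>R q x"
    proof (cases "0 \<le> c")
      case True
      then show ?thesis by (simp add: sublinear_scale[OF q])
    next
      case False
      then have "q ((- c) *\<^sub>R x) = - c * q x"
        by (intro sublinear_scale[OF q]) simp
      then show ?thesis
        using odd[of "c *\<^sub>R x"] by simp
    qed
  qed
  then show ?thesis using qp by blast
qed

text \<open>Any linear functional below the auxiliary \<open>q\<close> inherits both bounds: it lies
  below \<open>p\<close>, and its value at \<open>m\<close> is minus its value at
  \<open>- m\<close>, hence at least \<open>c\<close>.\<close>

theorem Mazur_Orlicz_cone:
  fixes p :: "'a::real_vector \<Rightarrow> real" and C :: "('a \<times> real) set"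
  assumes p: "sublinear p"
    and "0 \<in> C"
    and "\<And>a b. a \<in> C \<Longrightarrow> b \<in> C \<Longrightarrow> a + b \<in> C"
    and "\<And>t a. 0 \<le> t \<Longrightarrow> a \<in> C \<Longrightarrow> t *\<^sub>R a \<in> C"
    and "\<And>m c. (m, c) \<in> C \<Longrightarrow> c \<le> p m"
  obtains L where "linear L" "\<And>x. L x \<le> p x" "\<And>m c. (m, c) \<in> C \<Longrightarrow> c \<le> L m"
proof -
  obtain q where q: "sublinear q" "\<And>x. q x \<le> p x" "\<And>m c. (m, c) \<in> C \<Longrightarrow> q (- m) \<le> - c"
    using sublinear_below_on_cone[OF assms] by blast
  obtain L where L: "linear L" "\<And>x. L x \<le> q x"
    using sublinear_dominates_linear[OF q(1)] by blast
  show ?thesis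
  proof
    show "L x \<le> p x" for x
      using L(2) q(2) order_trans by blast
    show "c \<le> L m" if "(m, c) \<in> C" for m c
      using L(2)[of "- m"] q(3)[OF that] linear_neg[OF L(1), of m] by linarith
  qed (fact L(1))
qed

section \<open>The dual of \<open>L\<^sup>1\<close>\<close>


lemma dominated_convergence_L1:
  fixes f :: "'a \<Rightarrow> real"
  assumes "f \<in> borel_measurable M" "\<And>i. s i \<in> borel_measurable M" "integrable M w"
    and lim: "AE x in M. (\<lambda>i. s i x) \<longlonglongrightarrow> f x"
    and bound: "\<And>i. AE x in M. \<bar>s i x\<bar> \<le> w x"
  shows "(\<lambda>i. \<integral>x. \<bar>s i x - f x\<bar> \<partial>M) \<longlonglongrightarrow> 0"
proof -
  have bound': "AE x in M. \<forall>i. \<bar>s i x\<bar> \<le> w x"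
    using bound by (simp add: AE_all_countable)
  have fw: "AE x in M. \<bar>f x\<bar> \<le> w x"
    using bound' lim
  proof eventually_elim
    case (elim x)
    then show ?case
      by (intro LIMSEQ_le_const2[OF tendsto_rabs]) auto
  qed
  have "(\<lambda>i. \<integral>x. \<bar>s i x - f x\<bar> \<partial>M) \<longlonglongrightarrow> (\<integral>x. 0 \<partial>M)"
  proof (rule integral_dominated_convergence[where w = "\<lambda>x. 2 * w x"])
    show "AE x in M. (\<lambda>i. \<bar>s i x - f x\<bar>) \<longlonglongrightarrow> 0"
      using lim
    proof eventually_elim
      case (elim x)
      then have "(\<lambda>i. s i x - f x) \<longlonglongrightarrow> f x - f x"
        by (intro tendsto_intros)
      then show ?case
        by (simp add: tendsto_rabs_zero)
    qed
    show "AE x in M. norm \<bar>s i x - f x\<bar> \<le> 2 * w x" for i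
      using bound[of i] fw by eventually_elim auto
  qed (use assms in auto)
  then show ?thesis by simp
qed

text \<open>Only the Lipschitz estimate enters, so the lemma covers an abstract functional and
  integration against a bounded function alike.\<close>

lemma L1_continuous_functional:
  fixes L :: "('a \<Rightarrow> real) \<Rightarrow> real"
  assumes diff: "\<And>u v. integrable M u \<Longrightarrow> integrable M v \<Longrightarrow> \<bar>L u - L v\<bar> \<le> B * (\<integral>x. \<bar>u x - v x\<bar> \<partial>M)"
    and s: "\<And>i. integrable M (s i)" and f: "integrable M f"
    and lim: "(\<lambda>i. \<integral>x. \<bar>s i x - f x\<bar> \<partial>M) \<longlonglongrightarrow> 0"
  shows "(\<lambda>i. L (s i)) \<longlonglongrightarrow> L f"
proof -
  have "(\<lambda>i. B * (\<integral>x. \<bar>s i x - f x\<bar> \<partial>M)) \<longlonglongrightarrow> 0"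
    using tendsto_mult_right_zero[OF lim] .
  then have "(\<lambda>i. L (s i) - L f) \<longlonglongrightarrow> 0"
    by (rule Lim_null_comparison[rotated]) (auto intro!: always_eventually diff s f)
  then show ?thesis
    by (simp add: LIM_zero_iff)
qed

lemma integral_mult_bounded_le:
  fixes u g :: "'a \<Rightarrow> real"
  assumes "integrable M u" "g \<in> borel_measurable M" "AE x in M. \<bar>g x\<bar> \<le> B"
  shows "integrable M (\<lambda>x. u x * g x)" "\<bar>\<integral>x. u x * g x \<partial>M\<bar> \<le> B * (\<integral>x. \<bar>u x\<bar> \<partial>M)"
proof -
  have bd: "AE x in M. norm (u x * g x) \<le> B * \<bar>u x\<bar>"
    using assms(3) by eventually_elim (auto simp: abs_mult mult.commute mult_right_mono)
  show int: "integrable M (\<lambda>x. u x * g x)"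
    by (rule Bochner_Integration.integrable_bound[of _ "\<lambda>x. B * \<bar>u x\<bar>"])
       (use assms bd in \<open>auto elim: eventually_mono\<close>)
  have "\<bar>\<integral>x. u x * g x \<partial>M\<bar> \<le> (\<integral>x. \<bar>u x * g x\<bar> \<partial>M)"
    by (rule integral_abs_bound)
  also have "\<dots> \<le> (\<integral>x. B * \<bar>u x\<bar> \<partial>M)"
    using assms int bd by (intro integral_mono_AE) auto
  finally show "\<bar>\<integral>x. u x * g x \<partial>M\<bar> \<le> B * (\<integral>x. \<bar>u x\<bar> \<partial>M)"
    by simp
qed

text \<open>The functional acts on functions instead of classes; \<open>L_bound\<close> applied to a
  difference makes it agree on functions that are equal almost everywhere.\<close>

locale bounded_L1_functional =
  fixes M :: "'a measure" and L :: "('a \<Rightarrow> real) \<Rightarrow> real" and B :: real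
  assumes L_add: "integrable M u \<Longrightarrow> integrable M v \<Longrightarrow> L (\<lambda>x. u x + v x) = L u + L v"
    and L_scale: "integrable M u \<Longrightarrow> L (\<lambda>x. c * u x) = c * L u"
    and L_bound: "integrable M u \<Longrightarrow> \<bar>L u\<bar> \<le> B * (\<integral>x. \<bar>u x\<bar> \<partial>M)"
begin

lemma L_zero: "L (\<lambda>x. 0) = 0"
  using L_scale[of "\<lambda>x. 0" 0] by simp

lemma L_diff: "integrable M u \<Longrightarrow> integrable M v \<Longrightarrow> \<bar>L u - L v\<bar> \<le> B * (\<integral>x. \<bar>u x - v x\<bar> \<partial>M)"
  using L_add[of u "\<lambda>x. (- 1) * v x"] L_scale[of v "- 1"] L_bound[of "\<lambda>x. u x - v x"] by simp

lemmas L_tendsto = L1_continuous_functional[OF L_diff]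

text \<open>On a finite measure space the constant 1 dominates, so the indicators of the partial
  unions converge in the L1 norm. Continuity of \<open>L\<close> turns this into countable
  additivity of its values on indicators.\<close>

lemma L_indicator_sums:
  assumes "finite_measure M" and A: "range A \<subseteq> sets M" "disjoint_family A"
  shows "(\<lambda>n. L (indicator (A n))) sums L (indicator (\<Union>n. A n))"
proof -
  interpret finite_measure M by fact
  have [measurable]: "A i \<in> sets M" for i using A by auto
  have ind: "(\<lambda>x. \<Sum>i<n. indicator (A i) x :: real) = indicator (\<Union>i<n. A i)" for n
    using A(2) by (intro ext, subst indicator_UN_disjoint) (auto simp: disjoint_family_on_def)
  have fin: "(\<Sum>i<n. L (indicator (A i))) = L (\<lambda>x. \<Sum>i<n. indicator (A i) x)" for n
  proof (induction n)
    case (Suc n)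
    then show ?case
      by (subst sum.lessThan_Suc, subst Suc, subst L_add[symmetric])
         (auto simp: emeasure_eq_measure less_top[symmetric])
  qed (simp add: L_zero)
  have "(\<lambda>n. L (indicator (\<Union>i<n. A i))) \<longlonglongrightarrow> L (indicator (\<Union>i. A i))"
  proof (rule L_tendsto)
    show "(\<lambda>n. \<integral>x. \<bar>indicator (\<Union>i<n. A i) x - indicator (\<Union>i. A i) x :: real\<bar> \<partial>M) \<longlonglongrightarrow> 0"
    proof (rule dominated_convergence_L1[where w = "\<lambda>x. 1"])
      show "AE x in M. (\<lambda>n. indicator (\<Union>i<n. A i) x :: real) \<longlonglongrightarrow> indicator (\<Union>i. A i) x"
        by (intro AE_I2 LIMSEQ_indicator_UN)
    qed (auto simp: indicator_def)
  qed (auto simp: emeasure_eq_measure less_top[symmetric])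
  then show ?thesis
    by (simp add: sums_def fin ind)
qed

text \<open>The values of \<open>L\<close> on indicators form a signed measure. Adding
  \<open>B\<close> times the given measure makes it nonnegative, so the Radon-Nikodym theorem for
  nonnegative measures applies; subtracting \<open>B\<close> from the density undoes the
  shift.\<close>

lemma representation_finite:
  assumes fin: "finite_measure M"
  shows "\<exists>g\<in>borel_measurable M. (AE x in M. \<bar>g x\<bar> \<le> B) \<and> (\<forall>u. integrable M u \<longrightarrow> L u = (\<integral>x. u x * g x \<partial>M))"
proof -
  interpret finite_measure M by fact
  define m where "m A = L (indicator A) + B * measure M A" for A
  define N where "N = measure_of (space M) (sets M) (\<lambda>A. ennreal (m A))"
  have Lm: "\<bar>L (indicator A)\<bar> \<le> B * measure M A" if "A \<in> sets M" for A
    using L_bound[of "indicator A"] that by (simp add: emeasure_eq_measure)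
  have m_nonneg: "0 \<le> m A" if "A \<in> sets M" for A
    using Lm[OF that] by (auto simp: m_def)
  have emN: "emeasure N A = ennreal (m A)" if "A \<in> sets M" for A
  proof (rule emeasure_measure_of[OF N_def])
    show "sets M \<subseteq> Pow (space M)" by (rule sets.space_closed)
    have setsN: "sets N = sets M" by (simp add: N_def)
    show "A \<in> sets N" using that by (simp add: setsN)
    show "positive (sets N) (\<lambda>A. ennreal (m A))"
      using Lm[of "{}"] by (simp add: positive_def m_def)
    show "countably_additive (sets N) (\<lambda>A. ennreal (m A))"
    proof (rule countably_additiveI)
      fix A :: "nat \<Rightarrow> 'a set"
      assume A: "range A \<subseteq> sets N" "disjoint_family A" "\<Union> (range A) \<in> sets N"
      have "(\<lambda>n. m (A n)) sums m (\<Union>n. A n)"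
        unfolding m_def using A setsN
        by (intro sums_add sums_mult L_indicator_sums fin finite_measure_UNION) auto
      then show "(\<Sum>n. ennreal (m (A n))) = ennreal (m (\<Union> (range A)))"
        using A m_nonneg setsN by (intro suminf_ennreal_eq) auto
    qed
  qed
  have setsN: "sets N = sets M" by (simp add: N_def)
  have "absolutely_continuous M N"
    unfolding absolutely_continuous_def
  proof
    fix A assume "A \<in> null_sets M"
    then have A: "A \<in> sets M" "measure M A = 0"
      by (auto simp: measure_def)
    then have "m A = 0"
      using Lm[of A] by (simp add: m_def)
    then show "A \<in> null_sets N"
      using A emN by (simp add: null_sets_def setsN)
  qed
  then obtain d where d[measurable]: "d \<in> borel_measurable M" and dN: "density M d = N"
    using Radon_Nikodym setsN by blast
  have emd: "(\<integral>\<^sup>+x. d x * indicator A x \<partial>M) = ennreal (m A)" if "A \<in> sets M" for A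
    using emN[OF that] that by (simp add: dN[symmetric] emeasure_density)
  have fin_d: "(\<integral>\<^sup>+x. d x \<partial>M) < \<infinity>"
  proof -
    have "(\<integral>\<^sup>+x. d x \<partial>M) = (\<integral>\<^sup>+x. d x * indicator (space M) x \<partial>M)"
      by (rule nn_integral_cong) simp
    then show ?thesis
      using emd[OF sets.top] by simp
  qed
  then have d_fin: "AE x in M. d x \<noteq> \<infinity>"
    by (intro nn_integral_PInf_AE) auto
  \<comment> \<open>A real-valued version of the density, which is finite almost everywhere because
    the total mass \<open>m (space M)\<close> is finite.\<close>
  define e where "e x = enn2real (d x)" for x
  have e[measurable]: "e \<in> borel_measurable M" unfolding e_def[abs_def] by measurable
  have de: "AE x in M. ennreal (e x) = d x"
    using d_fin by eventually_elim (simp add: e_def less_top)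
  have int_e: "integrable M e"
  proof (rule integrableI_nonneg)
    have "(\<integral>\<^sup>+x. e x \<partial>M) = (\<integral>\<^sup>+x. d x \<partial>M)"
      using de by (rule nn_integral_cong_AE)
    with fin_d show "(\<integral>\<^sup>+x. e x \<partial>M) < \<infinity>" by simp
  qed (auto simp: e_def)
  have int_e_A: "(\<integral>x. indicator A x * e x \<partial>M) = m A" if A[measurable]: "A \<in> sets M" for A
  proof -
    have "(\<integral>\<^sup>+x. ennreal (indicator A x * e x) \<partial>M) = (\<integral>\<^sup>+x. d x * indicator A x \<partial>M)"
      using de by (intro nn_integral_cong_AE) (auto elim!: eventually_mono simp: indicator_def)
    then show ?thesis
      using emd[OF A] m_nonneg[OF A] by (subst integral_eq_nn_integral) (auto simp: e_def)
  qed
  define g where "g x = e x - B" for x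
  have g[measurable]: "g \<in> borel_measurable M" unfolding g_def[abs_def] by measurable
  have int_g: "integrable M g" unfolding g_def[abs_def] using int_e by simp
  have int_g_A: "(\<integral>x. indicator A x * g x \<partial>M) = L (indicator A)" "integrable M (\<lambda>x. indicator A x * g x)"
    if A[measurable]: "A \<in> sets M" for A
  proof -
    have "integrable M (\<lambda>x. indicator A x *\<^sub>R e x)"
      by (rule integrable_mult_indicator[OF A int_e])
    then have "integrable M (\<lambda>x. indicator A x * e x)" by simp
    then show "(\<integral>x. indicator A x * g x \<partial>M) = L (indicator A)"
      using int_e_A[OF A] A
      by (simp add: g_def right_diff_distrib m_def mult.commute[of _ B] emeasure_eq_measure less_top[symmetric])
    show "integrable M (\<lambda>x. indicator A x * g x)"
      using integrable_mult_indicator[OF A int_g] by simp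
  qed
  have indB: "(\<integral>x. indicator A x * B \<partial>M) = B * measure M A" "integrable M (\<lambda>x. indicator A x * B)"
    if "A \<in> sets M" for A
    using that by (auto simp: emeasure_eq_measure)
  \<comment> \<open>The integrals of \<open>B - g\<close> and \<open>B + g\<close> over every
    measurable set are nonnegative by \<open>Lm\<close>, hence so are the functions almost
    everywhere.\<close>
  have "AE x in M. 0 \<le> B - g x"
  proof (rule density_nonneg)
    show "0 \<le> (LINT x:A|M. B - g x)" if A: "A \<in> sets M" for A
      using int_g_A[OF A] indB[OF A] Lm[OF A] sets.Int_space_eq2[OF A]
      by (auto simp: set_lebesgue_integral_def right_diff_distrib mult.commute)
  qed (use int_g in auto)
  moreover have "AE x in M. 0 \<le> B + g x"
  proof (rule density_nonneg)
    show "0 \<le> (LINT x:A|M. B + g x)" if A: "A \<in> sets M" for A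
      using int_g_A[OF A] indB[OF A] Lm[OF A] sets.Int_space_eq2[OF A]
      by (auto simp: set_lebesgue_integral_def distrib_left mult.commute)
  qed (use int_g in auto)
  ultimately have gB: "AE x in M. \<bar>g x\<bar> \<le> B"
    by eventually_elim auto
  \<comment> \<open>The identity holds for indicators by construction of \<open>g\<close> and passes
    to limits because both sides are Lipschitz in the L1 norm.\<close>
  have "L u = (\<integral>x. u x * g x \<partial>M)" if "integrable M u" for u
    using that
  proof (induction u rule: integrable_induct)
    case (base A c)
    then show ?case
      using L_scale[of "indicator A" c] int_g_A[OF base(1)]
      by (simp add: mult.commute[of _ c] mult.assoc)
  next
    case (add u v)
    then show ?case
      using L_add[of u v] integral_mult_bounded_le(1)[OF _ g gB] by (simp add: distrib_right)
  next
    case (lim f s)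
    have "(\<lambda>i. \<integral>x. \<bar>s i x - f x\<bar> \<partial>M) \<longlonglongrightarrow> 0"
      by (rule dominated_convergence_L1[where w = "\<lambda>x. 2 * \<bar>f x\<bar>"]) (use lim in auto)
    then have "(\<lambda>i. L (s i)) \<longlonglongrightarrow> L f" "(\<lambda>i. \<integral>x. s i x * g x \<partial>M) \<longlonglongrightarrow> (\<integral>x. f x * g x \<partial>M)"
    proof -
      assume *: "(\<lambda>i. \<integral>x. \<bar>s i x - f x\<bar> \<partial>M) \<longlonglongrightarrow> 0"
      show "(\<lambda>i. L (s i)) \<longlonglongrightarrow> L f"
        using lim * by (intro L_tendsto) auto
      show "(\<lambda>i. \<integral>x. s i x * g x \<partial>M) \<longlonglongrightarrow> (\<integral>x. f x * g x \<partial>M)"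
      proof (rule L1_continuous_functional[where B = B and L = "\<lambda>u. \<integral>x. u x * g x \<partial>M"])
        show "\<bar>(\<integral>x. u x * g x \<partial>M) - (\<integral>x. v x * g x \<partial>M)\<bar> \<le> B * (\<integral>x. \<bar>u x - v x\<bar> \<partial>M)"
          if "integrable M u" "integrable M v" for u v
          using integral_mult_bounded_le[OF Bochner_Integration.integrable_diff[OF that] g gB]
            integral_mult_bounded_le(1)[OF that(1) g gB] integral_mult_bounded_le(1)[OF that(2) g gB]
          by (simp add: left_diff_distrib)
      qed (use lim * in auto)
    qed
    with lim show ?case
      by (auto intro: LIMSEQ_unique)
  qed
  with gB g show ?thesis by blast
qed

text \<open>Weighting by a positive integrable function reduces to a finite measure.\<close>

theorem representation:
  assumes "sigma_finite_measure M"
  obtains g where "g \<in> borel_measurable M" "AE x in M. \<bar>g x\<bar> \<le> B"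
    "\<And>u. integrable M u \<Longrightarrow> L u = (\<integral>x. u x * g x \<partial>M)"
proof -
  interpret sigma_finite_measure M by fact
  obtain h0 where h0[measurable]: "h0 \<in> borel_measurable M" and h0_fin: "integral\<^sup>N M h0 \<noteq> \<infinity>"
    and h0_pos: "\<And>x. x \<in> space M \<Longrightarrow> 0 < h0 x \<and> h0 x < \<infinity>"
    using Ex_finite_integrable_function by blast
  define h where "h x = enn2real (h0 x)" for x
  have h[measurable]: "h \<in> borel_measurable M" unfolding h_def[abs_def] by measurable
  have h_nonneg: "0 \<le> h x" for x by (simp add: h_def)
  have h_pos: "0 < h x" if "x \<in> space M" for x
    using h0_pos[OF that] by (simp add: h_def enn2real_positive_iff)
  define N where "N = density M (\<lambda>x. ennreal (h x))"
  have setsN[measurable_cong]: "sets N = sets M" by (simp add: N_def)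
  have intN: "integrable N u \<longleftrightarrow> integrable M (\<lambda>x. h x * u x)" if "u \<in> borel_measurable M" for u :: "'a \<Rightarrow> real"
    unfolding N_def using that h_nonneg by (subst integrable_density) auto
  have integralN: "(\<integral>x. u x \<partial>N) = (\<integral>x. h x * u x \<partial>M)" if "u \<in> borel_measurable M" for u :: "'a \<Rightarrow> real"
    unfolding N_def using that h_nonneg by (subst integral_density) auto
  have "finite_measure N"
  proof
    have "emeasure N (space N) = (\<integral>\<^sup>+x. ennreal (h x) \<partial>M)"
      by (simp add: N_def emeasure_density cong: nn_integral_cong)
    also have "\<dots> = integral\<^sup>N M h0"
      using h0_pos by (intro nn_integral_cong) (simp add: h_def)
    finally show "emeasure N (space N) \<noteq> \<infinity>"
      using h0_fin by simp
  qed
  have measN: "u \<in> borel_measurable M" if "integrable N u" for u :: "'a \<Rightarrow> real"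
    using borel_measurable_integrable[OF that] setsN by (simp cong: measurable_cong_sets)
  interpret N: bounded_L1_functional N "\<lambda>u. L (\<lambda>x. h x * u x)" B
  proof
    fix u v :: "'a \<Rightarrow> real" and c :: real
    assume u: "integrable N u"
    have *: "integrable M (\<lambda>x. h x * u x)"
      using u intN[OF measN[OF u]] by simp
    show "L (\<lambda>x. h x * (c * u x)) = c * L (\<lambda>x. h x * u x)"
      using L_scale[OF *, of c] by (simp add: algebra_simps)
    show "\<bar>L (\<lambda>x. h x * u x)\<bar> \<le> B * (\<integral>x. \<bar>u x\<bar> \<partial>N)"
      using L_bound[OF *] measN[OF u] h_nonneg by (simp add: integralN abs_mult)
    show "L (\<lambda>x. h x * (u x + v x)) = L (\<lambda>x. h x * u x) + L (\<lambda>x. h x * v x)"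
      if v: "integrable N v"
      using L_add[OF *, of "\<lambda>x. h x * v x"] v intN[OF measN[OF v]] by (simp add: algebra_simps)
  qed
  obtain g where g: "g \<in> borel_measurable N" "AE x in N. \<bar>g x\<bar> \<le> B"
    "\<And>u. integrable N u \<Longrightarrow> L (\<lambda>x. h x * u x) = (\<integral>x. u x * g x \<partial>N)"
    using N.representation_finite[OF \<open>finite_measure N\<close>] by blast
  have gM[measurable]: "g \<in> borel_measurable M"
    using g(1) setsN by (simp cong: measurable_cong_sets)
  have ae: "AE x in M. 0 < h x" using h_pos by simp
  show ?thesis
  proof
    show "AE x in M. \<bar>g x\<bar> \<le> B"
      using g(2) ae unfolding N_def by (subst (asm) AE_density) auto
    fix u :: "'a \<Rightarrow> real" assume u: "integrable M u"
    then have [measurable]: "u \<in> borel_measurable M" by simp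
    \<comment> \<open>The quotient \<open>u / h\<close>, cut to the space because \<open>h\<close>
      is known to be positive only there.\<close>
    define w where "w x = u x * indicator (space M) x / h x" for x
    have [measurable]: "w \<in> borel_measurable M" unfolding w_def[abs_def] by measurable
    have hw: "h x * w x = u x" if "x \<in> space M" for x
      using h_pos[OF that] that by (simp add: w_def)
    have "integrable M (\<lambda>x. h x * w x)"
      using u by (simp add: hw cong: Bochner_Integration.integrable_cong)
    then have "integrable N w" by (simp add: intN)
    \<comment> \<open>The two functions may differ outside the space; the Lipschitz bound
      \<open>L_diff\<close> does not see the difference.\<close>
    have "L u = L (\<lambda>x. h x * w x)"
    proof -
      have "(\<integral>x. \<bar>u x - h x * w x\<bar> \<partial>M) = (\<integral>x. 0 \<partial>M)"
        by (rule Bochner_Integration.integral_cong) (auto simp: hw)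
      then show ?thesis
        using L_diff[OF u \<open>integrable M (\<lambda>x. h x * w x)\<close>] by simp
    qed
    also have "\<dots> = (\<integral>x. w x * g x \<partial>N)"
      by (rule g(3)) fact
    also have "\<dots> = (\<integral>x. (h x * w x) * g x \<partial>M)"
      by (simp add: integralN mult.assoc)
    also have "\<dots> = (\<integral>x. u x * g x \<partial>M)"
      by (rule Bochner_Integration.integral_cong) (auto simp: hw)
    finally show "L u = (\<integral>x. u x * g x \<partial>M)" .
  qed fact
qed

end


section \<open>Density of continuous functions with bounded support in L1\<close>

lemma tendsto_cutoff_indicator:
  fixes K :: "'a::metric_space set"
  assumes "closed K" "K \<noteq> {}"
  shows "(\<lambda>n. max 0 (1 - real n * infdist x K)) \<longlonglongrightarrow> indicator K x"
proof (cases "x \<in> K")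
  case True
  then show ?thesis by simp
next
  case False
  then have d: "0 < infdist x K"
    using assms infdist_pos_not_in_closed by blast
  obtain n0 :: nat where "1 / infdist x K \<le> real n0"
    using real_arch_simple by blast
  then have "max 0 (1 - real n * infdist x K) = 0" if "n \<ge> n0" for n
  proof -
    have "1 / infdist x K \<le> real n"
      using \<open>1 / infdist x K \<le> real n0\<close> that by linarith
    then show ?thesis using d by (simp add: field_simps)
  qed
  then have "\<forall>\<^sub>F n in sequentially. max 0 (1 - real n * infdist x K) = 0"
    by (auto simp: eventually_sequentially)
  then show ?thesis
    using False by (simp add: tendsto_eventually)
qed

text \<open>A compact set is approximated by distance cutoffs, a closed set of finite measure by its
  intersections with balls, and a measurable set by closed subsets through regularity of Lebesgue
  measure. The rule reduces weak convergence of mollifications to continuous test functions.\<close>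

lemma integrable_induct_continuous [consumes 1, case_names cont add scale lim]:
  fixes f :: "'a::euclidean_space \<Rightarrow> real"
  assumes "integrable lborel f"
    and cont: "\<And>f R. continuous_on UNIV f \<Longrightarrow> (\<And>x. R < norm x \<Longrightarrow> f x = 0) \<Longrightarrow> P f"
    and add: "\<And>f g. integrable lborel f \<Longrightarrow> P f \<Longrightarrow> integrable lborel g \<Longrightarrow> P g \<Longrightarrow> P (\<lambda>x. f x + g x)"
    and scale: "\<And>f c. integrable lborel f \<Longrightarrow> P f \<Longrightarrow> P (\<lambda>x. c * f x)"
    and lim: "\<And>f s. (\<And>i. integrable lborel (s i)) \<Longrightarrow> (\<And>i. P (s i)) \<Longrightarrow> integrable lborel f \<Longrightarrow>
       (\<lambda>i. \<integral>x. \<bar>s i x - f x\<bar> \<partial>lborel) \<longlonglongrightarrow> 0 \<Longrightarrow> P f"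
  shows "P f"
proof -
  have compact: "P (indicator K)" if K: "compact K" for K
  proof (cases "K = {}")
    case True
    then show ?thesis
      by (intro cont[of _ 0]) auto
  next
    case False
    \<comment> \<open>With \<open>Suc n\<close> the slope is at least 1 from the start, so every
      cutoff vanishes at distance 1 from \<open>K\<close> and all of them live in one ball of radius
      \<open>R + 1\<close>.\<close>
    define s where "s n x = max 0 (1 - real (Suc n) * infdist x K)" for n x
    obtain R where R: "\<And>x. x \<in> K \<Longrightarrow> norm x \<le> R"
      using K compact_imp_bounded bounded_iff by metis
    have cont_s: "continuous_on UNIV (s n)" for n
      unfolding s_def by (intro continuous_intros)
    have s_zero: "s n x = 0" if "R + 1 < norm x" for n x
    proof -
      obtain y where y: "y \<in> K" "infdist x K = dist x y"
        using infdist_attains_inf[of K x] K False compact_imp_closed by blast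
      have "norm x \<le> norm y + dist x y"
        by (metis dist_norm norm_triangle_sub)
      then have "1 \<le> infdist x K"
        using R[OF y(1)] that y by linarith
      then have "1 * 1 \<le> real (Suc n) * infdist x K"
        by (intro mult_mono) auto
      then show ?thesis by (simp add: s_def)
    qed
    have s01: "\<bar>s n x\<bar> \<le> indicator (cball 0 (R + 1)) x" for n x
    proof (cases "norm x \<le> R + 1")
      case True
      have "0 \<le> real (Suc n) * infdist x K"
        by (intro mult_nonneg_nonneg) (auto simp: infdist_nonneg)
      then show ?thesis
        using True by (auto simp: s_def)
    qed (simp add: s_zero)
    have int_ball: "integrable lborel (indicator (cball 0 (R + 1)) :: 'a \<Rightarrow> real)"
      by (intro integrable_real_indicator emeasure_bounded_finite) auto
    have int_s: "integrable lborel (s n)" for n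
      by (rule Bochner_Integration.integrable_bound[OF int_ball])
         (use s01 cont_s in \<open>auto intro: borel_measurable_continuous_onI\<close>)
    show ?thesis
    proof (rule lim[of s])
      show "P (s n)" for n
        using cont_s s_zero by (rule cont)
      show "integrable lborel (indicator K :: 'a \<Rightarrow> real)"
        using K emeasure_compact_finite
        by (intro integrable_real_indicator) (auto intro: borel_compact)
      show "(\<lambda>n. \<integral>x. \<bar>s n x - indicator K x\<bar> \<partial>lborel) \<longlonglongrightarrow> 0"
      proof (rule dominated_convergence_L1[where w = "indicator (cball 0 (R + 1))"])
        show "AE x in lborel. (\<lambda>n. s n x) \<longlonglongrightarrow> indicator K x"
          unfolding s_def using K False
          by (intro AE_I2 LIMSEQ_Suc tendsto_cutoff_indicator compact_imp_closed)
      qed (use s01 int_s int_ball K in \<open>auto intro: borel_compact borel_measurable_indicator\<close>)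
    qed (rule int_s)
  qed
  have closed: "P (indicator F)" if F: "closed F" "emeasure lborel F < \<infinity>" for F
  proof (rule lim[of "\<lambda>n. indicator (F \<inter> cball 0 (real n))"])
    show int: "integrable lborel (indicator F :: 'a \<Rightarrow> real)"
      using F by (intro integrable_real_indicator) auto
    show "(\<lambda>n. \<integral>x. \<bar>indicator (F \<inter> cball 0 (real n)) x - indicator F x\<bar> \<partial>(lborel :: 'a measure)) \<longlonglongrightarrow> (0::real)"
    proof (rule dominated_convergence_L1[where w = "indicator F"])
      have "(\<lambda>n. indicator (F \<inter> cball 0 (real n)) x :: real) \<longlonglongrightarrow> indicator F x" for x
      proof (rule tendsto_eventually)
        obtain n0 :: nat where "norm x \<le> real n0"
          using real_arch_simple by blast
        then show "\<forall>\<^sub>F n in sequentially. (indicator (F \<inter> cball 0 (real n)) x :: real) = indicator F x"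
          unfolding eventually_sequentially
          by (intro exI[of _ n0]) (auto simp: indicator_def)
      qed
      then show "AE x in lborel. (\<lambda>n. indicator (F \<inter> cball 0 (real n)) x :: real) \<longlonglongrightarrow> indicator F x"
        by simp
      show "AE x in lborel. \<bar>indicator (F \<inter> cball 0 (real n)) x :: real\<bar> \<le> indicator F x" for n
        by (auto simp: indicator_def)
    qed (use F int in \<open>auto intro!: borel_measurable_indicator\<close>)
    show "integrable lborel (indicator (F \<inter> cball 0 (real n)) :: 'a \<Rightarrow> real)" for n
      using F by (intro integrable_real_indicator emeasure_bounded_finite) auto
    show "P (indicator (F \<inter> cball 0 (real n)))" for n
      using F by (intro compact closed_Int_compact) auto
  qed
  show ?thesis
    using assms(1)
  proof (induction f rule: integrable_induct)
    case (base A c)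
    have A: "A \<in> sets borel" using base by simp
    \<comment> \<open>An open set slightly larger than the complement of \<open>A\<close> is the
      complement of a closed set slightly smaller than \<open>A\<close>.\<close>
    have "\<exists>F. closed F \<and> F \<subseteq> A \<and> emeasure lborel (A - F) < ennreal (1 / Suc n)" for n
    proof -
      obtain U where "open U" "- A \<subseteq> U" "emeasure lborel (U - (- A)) < ennreal (1 / Suc n)"
        using outer_regular_lborel[of "- A" "1 / Suc n"] A by auto
      then show ?thesis
        by (intro exI[of _ "- U"]) (auto simp: Int_commute Diff_eq)
    qed
    then obtain F where F: "\<And>n. closed (F n)" "\<And>n. F n \<subseteq> A"
      "\<And>n. emeasure lborel (A - F n) < ennreal (1 / Suc n)"
      by metis
    have finF: "emeasure lborel (F n) < \<infinity>" for n
      using emeasure_mono[OF F(2)[of n], of lborel] base by auto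
    have "P (indicator A)"
    proof (rule lim[of "\<lambda>n. indicator (F n)"])
      show "integrable lborel (indicator A :: 'a \<Rightarrow> real)"
        using base by (intro integrable_real_indicator) auto
      have "(\<integral>x. \<bar>indicator (F n) x - indicator A x\<bar> \<partial>lborel) = measure lborel (A - F n)" for n
      proof -
        have "(\<integral>x. \<bar>indicator (F n) x - indicator A x :: real\<bar> \<partial>lborel) = (\<integral>x. indicator (A - F n) x \<partial>lborel)"
          using F(2)[of n] by (intro Bochner_Integration.integral_cong) (auto simp: indicator_def)
        then show ?thesis by simp
      qed
      moreover have "measure lborel (A - F n) \<le> 1 / Suc n" for n
        using F(3)[of n] by (simp add: measure_def enn2real_leI)
      ultimately show "(\<lambda>n. \<integral>x. \<bar>indicator (F n) x - indicator A x :: real\<bar> \<partial>lborel) \<longlonglongrightarrow> 0"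
        by (intro tendsto_sandwich[OF _ _ tendsto_const LIMSEQ_inverse_real_of_nat])
           (auto simp: inverse_eq_divide)
      show "integrable lborel (indicator (F n) :: 'a \<Rightarrow> real)" for n
        using finF[of n] F(1)[of n] by (intro integrable_real_indicator) auto
      show "P (indicator (F n))" for n
        using finF F(1) by (intro closed)
    qed
    then have "P (\<lambda>x. c * indicator A x)"
      using base by (intro scale) auto
    then show ?case by (simp add: mult.commute)
  next
    case (add f g)
    then show ?case by (intro assms(3))
  next
    case (lim f s)
    show ?case
    proof (rule assms(5)[of s])
      show "(\<lambda>i. \<integral>x. \<bar>s i x - f x\<bar> \<partial>lborel) \<longlonglongrightarrow> 0"
        by (rule dominated_convergence_L1[where w = "\<lambda>x. 2 * \<bar>f x\<bar>"]) (use lim in auto)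
    qed (use lim in auto)
  qed
qed

section \<open>Compactly supported \<open>C\<^sup>1\<close> functions\<close>


text \<open>Vanishing outside a ball is compact support in Euclidean space, in a form where radii
  can be added and compared directly.\<close>

definition Cc :: "('a::euclidean_space \<Rightarrow> real) \<Rightarrow> bool" where
  "Cc f \<longleftrightarrow> continuous_on UNIV f \<and> (\<exists>R. \<forall>x. R < norm x \<longrightarrow> f x = 0)"

lemma Cc_continuous: "Cc f \<Longrightarrow> continuous_on UNIV f"
  by (simp add: Cc_def)

lemma Cc_borel: "Cc f \<Longrightarrow> f \<in> borel_measurable borel"
  by (simp add: Cc_continuous borel_measurable_continuous_onI)

lemma Cc_bounded:
  assumes "Cc f"
  obtains B where "\<And>x. \<bar>f x\<bar> \<le> B"
proof -
  obtain R where R: "\<And>x. R < norm x \<Longrightarrow> f x = 0"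
    using assms by (auto simp: Cc_def)
  have "compact (f ` cball 0 R)"
    using assms by (auto intro!: compact_continuous_image continuous_on_subset[OF Cc_continuous])
  then obtain B where B: "\<And>x. norm x \<le> R \<Longrightarrow> \<bar>f x\<bar> \<le> B"
    using compact_imp_bounded bounded_iff by (metis image_eqI mem_cball_0 real_norm_def)
  have "\<bar>f x\<bar> \<le> max B 0" for x
    using B[of x] R[of x] by (cases "norm x \<le> R") auto
  then show ?thesis using that by blast
qed

lemma Cc_integrable:
  assumes "Cc f"
  shows "integrable lborel f"
proof -
  obtain R where R: "\<And>x. R < norm x \<Longrightarrow> f x = 0"
    using assms by (auto simp: Cc_def)
  obtain B where B: "\<And>x. \<bar>f x\<bar> \<le> B"
    using Cc_bounded[OF assms] by blast
  have "integrable lborel (\<lambda>x. B * indicator (cball 0 R) x :: real)"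
    by (intro integrable_mult_right integrable_real_indicator emeasure_bounded_finite) auto
  then show ?thesis
  proof (rule Bochner_Integration.integrable_bound)
    have "norm (f x) \<le> norm (B * indicator (cball 0 R) x :: real)" for x
      using R[of x] B[of x] by (cases "norm x \<le> R") auto
    then show "AE x in lborel. norm (f x) \<le> norm (B * indicator (cball 0 R) x :: real)"
      by simp
  qed (simp add: Cc_borel[OF assms])
qed

lemma Cc_uniformly_continuous:
  fixes f :: "'a::euclidean_space \<Rightarrow> real"
  assumes "Cc f" "0 < e"
  obtains d where "0 < d" "\<And>x y. norm (x - y) < d \<Longrightarrow> \<bar>f x - f y\<bar> < e"
proof -
  obtain R where R: "\<And>x. R < norm x \<Longrightarrow> f x = 0"
    using assms by (auto simp: Cc_def)
  \<comment> \<open>The extra margin 1 pairs with the restriction \<open>d \<le> 1\<close>: if one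
    of two close points leaves the larger ball, both are outside the radius \<open>R\<close> and
    \<open>f\<close> vanishes at both.\<close>
  have "uniformly_continuous_on (cball 0 (R + 1)) f"
    using assms(1)
    by (intro compact_uniformly_continuous continuous_on_subset[OF Cc_continuous]) auto
  then obtain d where d: "0 < d"
    "\<And>x y. x \<in> cball 0 (R + 1) \<Longrightarrow> y \<in> cball 0 (R + 1) \<Longrightarrow> dist y x < d \<Longrightarrow> dist (f y) (f x) < e"
    unfolding uniformly_continuous_on_def using assms(2) by metis
  show ?thesis
  proof (rule that[of "min d 1"])
    fix x y :: 'a assume xy: "norm (x - y) < min d 1"
    have tri: "norm x \<le> norm y + norm (x - y)" "norm y \<le> norm x + norm (x - y)"
      using norm_triangle_sub[of x y] norm_triangle_sub[of y x] by (auto simp: norm_minus_commute)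
    show "\<bar>f x - f y\<bar> < e"
    proof (cases "norm x \<le> R + 1 \<and> norm y \<le> R + 1")
      case True
      then show ?thesis
        using d(2)[of y x] xy by (simp add: dist_norm)
    next
      case False
      then have "f x = 0" "f y = 0"
        using tri xy by (auto intro!: R)
      then show ?thesis using assms(2) by simp
    qed
  qed (use d in simp)
qed

lemma Cc_mult: "Cc f \<Longrightarrow> continuous_on UNIV g \<Longrightarrow> Cc (\<lambda>x. f x * g x)"
  unfolding Cc_def by (fastforce intro: continuous_intros)

section \<open>Partial derivatives and gradients in the plane\<close>

lemma partial_derivatives:
  fixes f :: "pt \<Rightarrow> real"
  assumes "(f has_derivative f') (at p)"
  shows "((\<lambda>t. f (t, snd p)) has_real_derivative f' (1, 0)) (at (fst p))"
    and "((\<lambda>t. f (fst p, t)) has_real_derivative f' (0, 1)) (at (snd p))"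
proof -
  interpret f': linear f'
    using assms by (rule has_derivative_linear)
  have "((\<lambda>t. f (t, snd p)) has_derivative (\<lambda>t. f' (t, 0))) (at (fst p))"
    by (rule has_derivative_compose[where f = "\<lambda>t. (t, snd p)" and g = f])
       (use assms in \<open>auto intro: has_derivative_Pair has_derivative_ident has_derivative_const\<close>)
  moreover have "(\<lambda>t. f' (t, 0)) = (*) (f' (1, 0))"
  proof
    fix t
    have "(t, 0) = t *\<^sub>R ((1, 0) :: pt)" by simp
    then show "f' (t, 0) = f' (1, 0) * t"
      by (simp only: f'.scaleR real_scaleR_def mult.commute)
  qed
  ultimately show "((\<lambda>t. f (t, snd p)) has_real_derivative f' (1, 0)) (at (fst p))"
    by (simp add: has_field_derivative_def)
  have "((\<lambda>t. f (fst p, t)) has_derivative (\<lambda>t. f' (0, t))) (at (snd p))"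
    by (rule has_derivative_compose[where f = "\<lambda>t. (fst p, t)" and g = f])
       (use assms in \<open>auto intro: has_derivative_Pair has_derivative_ident has_derivative_const\<close>)
  moreover have "(\<lambda>t. f' (0, t)) = (*) (f' (0, 1))"
  proof
    fix t
    have "(0, t) = t *\<^sub>R ((0, 1) :: pt)" by simp
    then show "f' (0, t) = f' (0, 1) * t"
      by (simp only: f'.scaleR real_scaleR_def mult.commute)
  qed
  ultimately show "((\<lambda>t. f (fst p, t)) has_real_derivative f' (0, 1)) (at (snd p))"
    by (simp add: has_field_derivative_def)
qed

lemma px_py_eqI:
  assumes "(f has_derivative (\<lambda>h. a * fst h + b * snd h)) (at p)"
  shows "px f p = a" "py f p = b"
  using partial_derivatives[OF assms] by (auto simp: px_def py_def intro: DERIV_imp_deriv)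

lemma differentiable_has_partials:
  fixes f :: "pt \<Rightarrow> real"
  assumes "f differentiable (at p)"
  shows "(f has_derivative (\<lambda>h. px f p * fst h + py f p * snd h)) (at p)"
proof -
  obtain f' where f': "(f has_derivative f') (at p)"
    using assms by (auto simp: differentiable_def)
  then interpret f': linear f'
    by (rule has_derivative_linear)
  have partials: "px f p = f' (1, 0)" "py f p = f' (0, 1)"
    using partial_derivatives[OF f'] by (auto simp: px_def py_def intro: DERIV_imp_deriv)
  have "f' h = px f p * fst h + py f p * snd h" for h
  proof -
    have "h = fst h *\<^sub>R (1, 0) + snd h *\<^sub>R (0, 1)"
      by (simp add: prod_eq_iff)
    then have "f' h = f' (fst h *\<^sub>R (1, 0) + snd h *\<^sub>R (0, 1))"
      by simp
    then show ?thesis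
      by (simp only: partials f'.add f'.scaleR real_scaleR_def mult.commute)
  qed
  then have "f' = (\<lambda>h. px f p * fst h + py f p * snd h)" ..
  with f' show ?thesis by simp
qed

text \<open>Separates smoothness from compact support: the convolution of a bounded function with a
  test function is continuously differentiable but need not have bounded support. The gradient is
  carried along explicitly so that product and chain rules compute it.\<close>

definition C1_grad :: "(pt \<Rightarrow> real) \<Rightarrow> (pt \<Rightarrow> real) \<Rightarrow> (pt \<Rightarrow> real) \<Rightarrow> bool" where
  "C1_grad f a b \<longleftrightarrow> (\<forall>p. (f has_derivative (\<lambda>h. a p * fst h + b p * snd h)) (at p))
     \<and> continuous_on UNIV a \<and> continuous_on UNIV b"

lemma C1_grad_partials: "C1_grad f a b \<Longrightarrow> px f = a" "C1_grad f a b \<Longrightarrow> py f = b"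
  by (auto simp: C1_grad_def fun_eq_iff intro!: px_py_eqI)

lemma C1_grad_continuous: "C1_grad f a b \<Longrightarrow> continuous_on UNIV f"
  unfolding C1_grad_def
  by (meson continuous_at_imp_continuous_on has_derivative_continuous)

lemma C1c_iff: "C1c f \<longleftrightarrow> C1_grad f (px f) (py f) \<and> Cc f"
proof -
  have "compact (closure {p. f p \<noteq> 0}) \<longleftrightarrow> (\<exists>R. \<forall>x. R < norm x \<longrightarrow> f x = 0)"
    unfolding compact_closure bounded_iff by (simp add: not_less[symmetric]) metis
  moreover have "continuous_on UNIV f" if "\<forall>p. f differentiable at p"
    using that by (meson continuous_at_imp_continuous_on differentiable_imp_continuous_within)
  moreover have "(\<forall>p. f differentiable at p) \<longleftrightarrow>
      (\<forall>p. (f has_derivative (\<lambda>h. px f p * fst h + py f p * snd h)) (at p))"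
    using differentiable_has_partials[of f] unfolding differentiable_def by blast
  ultimately show ?thesis
    unfolding C1c_def C1_grad_def Cc_def by blast
qed

lemma C1cI: "C1_grad f a b \<Longrightarrow> (\<And>p. R < norm p \<Longrightarrow> f p = 0) \<Longrightarrow> C1c f"
  using C1_grad_partials[of f a b] C1_grad_continuous[of f a b] by (auto simp: C1c_iff Cc_def)

lemma C1c_C1_grad: "C1c f \<Longrightarrow> C1_grad f (px f) (py f)"
  by (simp add: C1c_iff)

lemma C1c_Cc:
  assumes "C1c f"
  shows "Cc f" "Cc (px f)" "Cc (py f)"
proof -
  show f: "Cc f" using assms by (simp add: C1c_iff)
  then obtain R where R: "\<And>x. R < norm x \<Longrightarrow> f x = 0"
    by (auto simp: Cc_def)
  have "px f p = 0 \<and> py f p = 0" if "R < norm p" for p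
  proof -
    \<comment> \<open>On this open region \<open>f\<close> is identically zero, so its derivative
      vanishes there and the partials have the same support radius as \<open>f\<close>.\<close>
    have "open {p :: pt. R < norm p}"
      by (intro open_Collect_less continuous_intros)
    then have "(f has_derivative (\<lambda>h. 0)) (at p)"
      by (rule has_derivative_transform_within_open[OF has_derivative_const[of 0]])
         (use that R in auto)
    then show ?thesis
      using px_py_eqI[of f 0 0 p] by simp
  qed
  then show "Cc (px f)" "Cc (py f)"
    using assms by (auto simp: Cc_def C1c_def)
qed

lemma C1_gradI:
  assumes "\<And>p. (f has_derivative (\<lambda>h. a p * fst h + b p * snd h)) (at p)"
    "continuous_on UNIV a" "continuous_on UNIV b"
  shows "C1_grad f a b"
  using assms by (simp add: C1_grad_def)

lemma C1_gradD:
  assumes "C1_grad f a b"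
  shows "(f has_derivative (\<lambda>h. a p * fst h + b p * snd h)) (at p)"
    "continuous_on UNIV a" "continuous_on UNIV b"
  using assms unfolding C1_grad_def by blast+

lemma C1_grad_add:
  assumes "C1_grad f a b" "C1_grad g a' b'"
  shows "C1_grad (\<lambda>p. f p + g p) (\<lambda>p. a p + a' p) (\<lambda>p. b p + b' p)"
proof (rule C1_gradI)
  show "((\<lambda>p. f p + g p) has_derivative (\<lambda>h. (a p + a' p) * fst h + (b p + b' p) * snd h)) (at p)" for p
    by (rule has_derivative_add[OF C1_gradD(1)[OF assms(1)] C1_gradD(1)[OF assms(2)], THEN has_derivative_eq_rhs])
       (simp add: fun_eq_iff algebra_simps)
qed (intro continuous_intros C1_gradD[OF assms(1)] C1_gradD[OF assms(2)])+

lemma C1_grad_mult: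
  assumes "C1_grad f a b" "C1_grad g a' b'"
  shows "C1_grad (\<lambda>p. f p * g p) (\<lambda>p. f p * a' p + a p * g p) (\<lambda>p. f p * b' p + b p * g p)"
proof (rule C1_gradI)
  show "((\<lambda>p. f p * g p) has_derivative
      (\<lambda>h. (f p * a' p + a p * g p) * fst h + (f p * b' p + b p * g p) * snd h)) (at p)" for p
    by (rule has_derivative_mult[OF C1_gradD(1)[OF assms(1)] C1_gradD(1)[OF assms(2)], THEN has_derivative_eq_rhs])
       (simp add: fun_eq_iff algebra_simps)
qed (intro continuous_intros C1_gradD[OF assms(1)] C1_gradD[OF assms(2)]
      C1_grad_continuous[OF assms(1)] C1_grad_continuous[OF assms(2)])+

lemma C1_grad_cmult:
  assumes "C1_grad f a b"
  shows "C1_grad (\<lambda>p. c * f p) (\<lambda>p. c * a p) (\<lambda>p. c * b p)"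
proof (rule C1_gradI)
  show "((\<lambda>p. c * f p) has_derivative (\<lambda>h. c * a p * fst h + c * b p * snd h)) (at p)" for p
    by (rule has_derivative_mult_right[OF C1_gradD(1)[OF assms], THEN has_derivative_eq_rhs])
       (simp add: fun_eq_iff algebra_simps)
qed (intro continuous_intros C1_gradD[OF assms])+

text \<open>One rule for the two substitutions that occur: reflection (\<open>c = - 1\<close>) for
  testing the divergence with a convolution kernel, and dilation for mollifiers and cutoffs.\<close>

lemma C1_grad_affine:
  assumes "C1_grad f a b"
  shows "C1_grad (\<lambda>p. f (x + c *\<^sub>R p)) (\<lambda>p. c * a (x + c *\<^sub>R p)) (\<lambda>p. c * b (x + c *\<^sub>R p))"
proof (rule C1_gradI)
  fix p
  have "((\<lambda>p. x + c *\<^sub>R p) has_derivative (\<lambda>h. c *\<^sub>R h)) (at p)"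
    by (auto intro!: derivative_eq_intros)
  from has_derivative_compose[OF this C1_gradD(1)[OF assms]]
  show "((\<lambda>p. f (x + c *\<^sub>R p)) has_derivative
      (\<lambda>h. c * a (x + c *\<^sub>R p) * fst h + c * b (x + c *\<^sub>R p) * snd h)) (at p)"
    by (rule has_derivative_eq_rhs) (simp add: fun_eq_iff algebra_simps)
next
  show "continuous_on UNIV (\<lambda>p. c * a (x + c *\<^sub>R p))" "continuous_on UNIV (\<lambda>p. c * b (x + c *\<^sub>R p))"
    by (auto intro!: continuous_intros continuous_on_compose2[OF C1_gradD(2)[OF assms]]
        continuous_on_compose2[OF C1_gradD(3)[OF assms]])
qed

lemma C1c_cmult:
  assumes "C1c f"
  shows "C1c (\<lambda>p. c * f p)" "px (\<lambda>p. c * f p) = (\<lambda>p. c * px f p)" "py (\<lambda>p. c * f p) = (\<lambda>p. c * py f p)"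
proof -
  note g = C1_grad_cmult[OF C1c_C1_grad[OF assms], of c]
  obtain R where "\<And>x. R < norm x \<Longrightarrow> f x = 0"
    using C1c_Cc(1)[OF assms] by (auto simp: Cc_def)
  then show "C1c (\<lambda>p. c * f p)"
    by (intro C1cI[OF g, of R]) auto
  show "px (\<lambda>p. c * f p) = (\<lambda>p. c * px f p)" "py (\<lambda>p. c * f p) = (\<lambda>p. c * py f p)"
    using C1_grad_partials[OF g] by auto
qed

lemma C1c_uminus:
  assumes "C1c f"
  shows "C1c (\<lambda>p. - f p)" "px (\<lambda>p. - f p) = (\<lambda>p. - px f p)" "py (\<lambda>p. - f p) = (\<lambda>p. - py f p)"
  using C1c_cmult[OF assms, of "- 1"] by simp_all

lemma C1c_add:
  assumes "C1c f" "C1c g"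
  shows "C1c (\<lambda>p. f p + g p)" "px (\<lambda>p. f p + g p) = (\<lambda>p. px f p + px g p)"
    "py (\<lambda>p. f p + g p) = (\<lambda>p. py f p + py g p)"
proof -
  note g = C1_grad_add[OF C1c_C1_grad[OF assms(1)] C1c_C1_grad[OF assms(2)]]
  obtain R R' where "\<And>x. R < norm x \<Longrightarrow> f x = 0" "\<And>x. R' < norm x \<Longrightarrow> g x = 0"
    using C1c_Cc(1)[OF assms(1)] C1c_Cc(1)[OF assms(2)] by (auto simp: Cc_def)
  then show "C1c (\<lambda>p. f p + g p)"
    by (intro C1cI[OF g, of "max R R'"]) auto
  show "px (\<lambda>p. f p + g p) = (\<lambda>p. px f p + px g p)" "py (\<lambda>p. f p + g p) = (\<lambda>p. py f p + py g p)"
    using C1_grad_partials[OF g] by auto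
qed

lemma C1c_mult:
  assumes "C1c f" "C1_grad g a b"
  shows "C1c (\<lambda>p. f p * g p)" "px (\<lambda>p. f p * g p) = (\<lambda>p. f p * a p + px f p * g p)"
    "py (\<lambda>p. f p * g p) = (\<lambda>p. f p * b p + py f p * g p)"
proof -
  note g = C1_grad_mult[OF C1c_C1_grad[OF assms(1)] assms(2)]
  obtain R where "\<And>x. R < norm x \<Longrightarrow> f x = 0"
    using C1c_Cc(1)[OF assms(1)] by (auto simp: Cc_def)
  then show "C1c (\<lambda>p. f p * g p)"
    by (intro C1cI[OF g, of R]) auto
  show "px (\<lambda>p. f p * g p) = (\<lambda>p. f p * a p + px f p * g p)"
    "py (\<lambda>p. f p * g p) = (\<lambda>p. f p * b p + py f p * g p)"
    using C1_grad_partials[OF g] by auto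
qed

lemma C1c_affine:
  assumes "C1c f" "c \<noteq> 0"
  shows "C1c (\<lambda>p. f (x + c *\<^sub>R p))" "px (\<lambda>p. f (x + c *\<^sub>R p)) = (\<lambda>p. c * px f (x + c *\<^sub>R p))"
    "py (\<lambda>p. f (x + c *\<^sub>R p)) = (\<lambda>p. c * py f (x + c *\<^sub>R p))"
proof -
  note g = C1_grad_affine[OF C1c_C1_grad[OF assms(1)], of x c]
  obtain R where R: "\<And>x. R < norm x \<Longrightarrow> f x = 0"
    using C1c_Cc(1)[OF assms(1)] by (auto simp: Cc_def)
  have "R < norm (x + c *\<^sub>R p)" if "(R + norm x) / \<bar>c\<bar> < norm p" for p
  proof -
    have "R + norm x < norm (c *\<^sub>R p)"
      using that assms(2) by (simp add: field_simps)
    then show ?thesis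
      using norm_triangle_ineq2[of "c *\<^sub>R p" "- x"] by (simp add: add.commute)
  qed
  then show "C1c (\<lambda>p. f (x + c *\<^sub>R p))"
    by (intro C1cI[OF g]) (auto intro: R)
  show "px (\<lambda>p. f (x + c *\<^sub>R p)) = (\<lambda>p. c * px f (x + c *\<^sub>R p))"
    "py (\<lambda>p. f (x + c *\<^sub>R p)) = (\<lambda>p. c * py f (x + c *\<^sub>R p))"
    using C1_grad_partials[OF g] by auto
qed

section \<open>Integration by parts for test functions\<close>

lemma integral_deriv_compact_support:
  fixes F f :: "real \<Rightarrow> real"
  assumes "\<And>x. (F has_real_derivative f x) (at x)" "continuous_on UNIV f"
    and "\<And>x. R < \<bar>x\<bar> \<Longrightarrow> F x = 0" "\<And>x. R < \<bar>x\<bar> \<Longrightarrow> f x = 0"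
  shows "(\<integral>x. f x \<partial>lborel) = 0"
proof -
  \<comment> \<open>Strictly larger than \<open>R\<close> and positive, so \<open>F\<close> vanishes
    at both ends of the interval, which is nonempty even for negative \<open>R\<close>.\<close>
  define S where "S = \<bar>R\<bar> + 1"
  have "(\<integral>x. f x \<partial>lborel) = (\<integral>x. f x * indicator {- S .. S} x \<partial>lborel)"
  proof (rule Bochner_Integration.integral_cong)
    show "f x = f x * indicator {- S .. S} x" for x
      using assms(4)[of x] by (cases "R < \<bar>x\<bar>") (auto simp: S_def indicator_def)
  qed simp
  also have "\<dots> = F S - F (- S)"
    by (rule integral_FTC_Icc_real)
       (use assms in \<open>auto simp: S_def continuous_on_eq_continuous_at\<close>)
  also have "\<dots> = 0"
    using assms(3)[of S] assms(3)[of "- S"] by (simp add: S_def)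
  finally show ?thesis .
qed

text \<open>By Fubini the inner integral can be taken along the direction of differentiation, where
  the fundamental theorem of calculus gives zero.\<close>

lemma C1c_integral_partials:
  assumes "C1c f"
  shows "(\<integral>p. px f p \<partial>lborel) = 0" "(\<integral>p. py f p \<partial>lborel) = 0"
proof -
  note Cc = C1c_Cc[OF assms]
  obtain R1 R2 R3 where R: "\<And>x. R1 < norm x \<Longrightarrow> f x = 0" "\<And>x. R2 < norm x \<Longrightarrow> px f x = 0"
    "\<And>x. R3 < norm x \<Longrightarrow> py f x = 0"
    using Cc unfolding Cc_def by metis
  define R where "R = max R1 (max R2 R3)"
  have fst_le: "R < norm (x, y)" if "R < \<bar>x\<bar>" for x y :: real
    using that norm_fst_le[of x y] by (auto intro: less_le_trans)
  have snd_le: "R < norm (x, y)" if "R < \<bar>y\<bar>" for x y :: real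
    using that norm_snd_le[of y x] by (auto intro: less_le_trans)
  have der: "(f has_derivative (\<lambda>h. px f p * fst h + py f p * snd h)) (at p)" for p
    using C1_gradD(1)[OF C1c_C1_grad[OF assms]] .
  have X: "(\<integral>p. px f p \<partial>lborel) = (\<integral>y. (\<integral>x. px f (x, y) \<partial>lborel) \<partial>lborel)"
    using lborel_pair.integral_snd[of "\<lambda>x y. px f (x, y)"] Cc_integrable[OF Cc(2)]
    by (simp add: lborel_prod)
  have "(\<integral>x. px f (x, y) \<partial>lborel) = 0" for y
  proof (rule integral_deriv_compact_support[where F = "\<lambda>x. f (x, y)" and R = R])
    show "((\<lambda>x. f (x, y)) has_real_derivative px f (x, y)) (at x)" for x
      using partial_derivatives(1)[OF der[of "(x, y)"]] by simp
    show "continuous_on UNIV (\<lambda>x. px f (x, y))"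
      by (rule continuous_on_compose2[OF Cc_continuous[OF Cc(2)]]) (auto intro!: continuous_intros)
  qed (use R fst_le in \<open>auto simp: R_def\<close>)
  with X show "(\<integral>p. px f p \<partial>lborel) = 0" by simp
  have Y: "(\<integral>p. py f p \<partial>lborel) = (\<integral>x. (\<integral>y. py f (x, y) \<partial>lborel) \<partial>lborel)"
    using lborel_pair.integral_fst'[of "py f"] Cc_integrable[OF Cc(3)]
    by (simp add: lborel_prod)
  have "(\<integral>y. py f (x, y) \<partial>lborel) = 0" for x
  proof (rule integral_deriv_compact_support[where F = "\<lambda>y. f (x, y)" and R = R])
    show "((\<lambda>y. f (x, y)) has_real_derivative py f (x, y)) (at y)" for y
      using partial_derivatives(2)[OF der[of "(x, y)"]] by simp
    show "continuous_on UNIV (\<lambda>y. py f (x, y))"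
      by (rule continuous_on_compose2[OF Cc_continuous[OF Cc(3)]]) (auto intro!: continuous_intros)
  qed (use R snd_le in \<open>auto simp: R_def\<close>)
  with Y show "(\<integral>p. py f p \<partial>lborel) = 0" by simp
qed

text \<open>The partial derivatives of the products \<open>f * v1\<close> and \<open>f * v2\<close>
  have integral zero; the product rule splits them.\<close>

lemma C1c_integral_by_parts:
  assumes "C1c f" "C1c v1" "C1c v2"
  shows "(\<integral>p. f p * (px v1 p + py v2 p) \<partial>lborel) = - (\<integral>p. px f p * v1 p + py f p * v2 p \<partial>lborel)"
proof -
  note cont = C1c_Cc[THEN Cc_continuous]
  note m1 = C1c_mult[OF assms(1) C1c_C1_grad[OF assms(2)]]
  note m2 = C1c_mult[OF assms(1) C1c_C1_grad[OF assms(3)]]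
  have int: "integrable lborel (\<lambda>p. f p * px v1 p)" "integrable lborel (\<lambda>p. px f p * v1 p)"
    "integrable lborel (\<lambda>p. f p * py v2 p)" "integrable lborel (\<lambda>p. py f p * v2 p)"
    by (intro Cc_integrable Cc_mult[OF C1c_Cc(1)[OF assms(1)]] Cc_mult[OF C1c_Cc(2)[OF assms(1)]]
        Cc_mult[OF C1c_Cc(3)[OF assms(1)]] cont assms)+
  have "(\<integral>p. f p * px v1 p \<partial>lborel) + (\<integral>p. px f p * v1 p \<partial>lborel) = 0"
    using C1c_integral_partials(1)[OF m1(1)] int by (simp add: m1)
  moreover have "(\<integral>p. f p * py v2 p \<partial>lborel) + (\<integral>p. py f p * v2 p \<partial>lborel) = 0"
    using C1c_integral_partials(2)[OF m2(1)] int by (simp add: m2)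
  ultimately show ?thesis
    using int by (simp add: distrib_left)
qed

section \<open>Convolution\<close>


lemma lborel_distr_reflect:
  "distr lborel borel (\<lambda>x. t - x) = (lborel :: 'a::euclidean_space measure)"
  using lborel_affine[of "-1" t] by (simp add: density_1)

lemma lborel_reflect:
  fixes f :: "'a::euclidean_space \<Rightarrow> real"
  assumes "f \<in> borel_measurable borel"
  shows "integrable lborel (\<lambda>x. f (t - x)) \<longleftrightarrow> integrable lborel f"
    "(\<integral>x. f (t - x) \<partial>lborel) = (\<integral>x. f x \<partial>lborel)"
  using assms integrable_distr_eq[of "\<lambda>x. t - x" lborel borel f]
    integral_distr[of "\<lambda>x. t - x" lborel borel f]
  by (simp_all add: lborel_distr_reflect)

lemma lborel_translate:
  fixes f :: "'a::euclidean_space \<Rightarrow> real"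
  assumes "f \<in> borel_measurable borel"
  shows "(\<integral>x. f (x - t) \<partial>lborel) = (\<integral>x. f x \<partial>lborel)"
  using lborel_reflect(2)[of "\<lambda>x. f (- x)" t] lborel_reflect(2)[of f 0] assms by simp

lemma Cc_reflect:
  fixes f :: "'a::euclidean_space \<Rightarrow> real"
  assumes "Cc f"
  shows "Cc (\<lambda>y. f (x - y))"
proof -
  obtain R where R: "\<And>x. R < norm x \<Longrightarrow> f x = 0"
    using assms by (auto simp: Cc_def)
  have "f (x - y) = 0" if "R + norm x < norm y" for y
    using that norm_triangle_ineq2[of y x] by (intro R) (simp add: norm_minus_commute)
  moreover have "continuous_on UNIV (\<lambda>y. f (x - y))"
    by (rule continuous_on_compose2[OF Cc_continuous[OF assms]]) (auto intro!: continuous_intros)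
  ultimately show ?thesis by (auto simp: Cc_def)
qed

lemma Cc_translate:
  fixes f :: "'a::euclidean_space \<Rightarrow> real"
  assumes "Cc f"
  shows "Cc (\<lambda>y. f (y + x))"
  using Cc_reflect[OF Cc_reflect[OF assms, of 0], of "- x"] by (simp add: add.commute)

lemma Cc_add:
  assumes "Cc f" "Cc g"
  shows "Cc (\<lambda>x. f x + g x)"
proof -
  obtain R R' where "\<And>x. R < norm x \<Longrightarrow> f x = 0" "\<And>x. R' < norm x \<Longrightarrow> g x = 0"
    using assms by (auto simp: Cc_def)
  then have "\<forall>x. max R R' < norm x \<longrightarrow> f x + g x = 0" by simp
  moreover have "continuous_on UNIV (\<lambda>x. f x + g x)"
    using assms by (intro continuous_on_add Cc_continuous)
  ultimately show ?thesis unfolding Cc_def by blast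
qed

lemma Cc_cmult: "Cc f \<Longrightarrow> Cc (\<lambda>x. c * f x)"
  using Cc_mult[of f "\<lambda>x. c"] by (simp add: mult.commute)

definition conv :: "('a::euclidean_space \<Rightarrow> real) \<Rightarrow> ('a \<Rightarrow> real) \<Rightarrow> 'a \<Rightarrow> real" where
  "conv v r x = (\<integral>y. v y * r (x - y) \<partial>lborel)"

text \<open>A bounded factor of a convolution together with its bound. The bound holds only almost
  everywhere, whereas the bounds derived for convolutions hold at every point.\<close>

locale bounded_density =
  fixes v :: "'a::euclidean_space \<Rightarrow> real" and B :: real
  assumes v_borel [measurable]: "v \<in> borel_measurable borel"
    and v_bound: "AE y in lborel. \<bar>v y\<bar> \<le> B"
begin

lemma integrable_mult: "integrable lborel u \<Longrightarrow> integrable lborel (\<lambda>y. v y * u y)"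
  using integral_mult_bounded_le(1)[of lborel u v B] v_bound by (simp add: mult.commute)

lemma conv_integrable: "Cc r \<Longrightarrow> integrable lborel (\<lambda>y. v y * r (x - y))"
  by (intro integrable_mult Cc_integrable Cc_reflect)

lemma conv_bound:
  assumes "Cc r"
  shows "\<bar>conv v r x\<bar> \<le> B * (\<integral>y. \<bar>r y\<bar> \<partial>lborel)"
proof -
  have "\<bar>conv v r x\<bar> \<le> B * (\<integral>y. \<bar>r (x - y)\<bar> \<partial>lborel)"
    unfolding conv_def
    using integral_mult_bounded_le(2)[OF Cc_integrable[OF Cc_reflect[OF assms, of x]] _ v_bound]
    by (simp add: mult.commute)
  also have "(\<integral>y. \<bar>r (x - y)\<bar> \<partial>lborel) = (\<integral>y. \<bar>r y\<bar> \<partial>lborel)"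
    using lborel_reflect(2)[of "\<lambda>y. \<bar>r y\<bar>" x] Cc_borel[OF assms] by simp
  finally show ?thesis .
qed

lemma B_nonneg: "0 \<le> B"
proof (rule ccontr)
  assume "\<not> 0 \<le> B"
  then have "AE y in (lborel :: 'a measure). False"
    using v_bound by (auto elim!: eventually_mono)
  then show False by (simp add: ae_filter_eq_bot_iff)
qed

text \<open>Continuity and differentiability of a convolution both reduce to this: the difference or
  Taylor remainder of the kernel is uniformly small and supported in a fixed ball.\<close>

lemma conv_small:
  assumes "Cc r" "0 \<le> e" "\<And>z. \<bar>r z\<bar> \<le> e" "\<And>z. R < norm z \<Longrightarrow> r z = 0"
  shows "\<bar>conv v r x\<bar> \<le> e * (B * measure lborel (cball (0::'a) R))"
proof -
  have ind: "integrable lborel (indicator (cball 0 R) :: 'a \<Rightarrow> real)"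
    by (intro integrable_real_indicator emeasure_bounded_finite) auto
  have "(\<integral>y. \<bar>r y\<bar> \<partial>lborel) \<le> (\<integral>y. e * indicator (cball (0::'a) R) y \<partial>lborel)"
  proof (rule Bochner_Integration.integral_mono)
    show "\<bar>r y\<bar> \<le> e * indicator (cball 0 R) y" for y
      using assms(3)[of y] assms(4)[of y] by (cases "R < norm y") auto
  qed (use ind Cc_integrable[OF assms(1)] in auto)
  also have "\<dots> = e * measure lborel (cball (0::'a) R)"
    by simp
  finally have "B * (\<integral>y. \<bar>r y\<bar> \<partial>lborel) \<le> B * (e * measure lborel (cball (0::'a) R))"
    using B_nonneg by (rule mult_left_mono)
  with conv_bound[OF assms(1), of x] show ?thesis
    by (simp add: ac_simps)
qed

lemma conv_add: "Cc r \<Longrightarrow> Cc s \<Longrightarrow> conv v (\<lambda>z. r z + s z) x = conv v r x + conv v s x"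
  unfolding conv_def
  by (subst Bochner_Integration.integral_add[symmetric]) (auto intro: conv_integrable simp: distrib_left)

lemma conv_cmult: "conv v (\<lambda>z. c * r z) x = c * conv v r x"
  unfolding conv_def by (simp add: mult.left_commute)

lemma conv_translate: "conv v (\<lambda>z. r (z + h)) x = conv v r (x + h)"
  unfolding conv_def by (simp add: algebra_simps)

lemma conv_continuous:
  assumes "Cc r"
  shows "continuous_on UNIV (conv v r)"
  unfolding continuous_on_iff
proof (intro ballI allI impI)
  fix x :: 'a and e :: real assume "0 < e"
  obtain R where R: "\<And>x. R < norm x \<Longrightarrow> r x = 0"
    using assms by (auto simp: Cc_def)
  \<comment> \<open>The radius \<open>R + 1\<close> leaves room for shifts shorter than 1, and the
    denominator \<open>V + 1\<close> below stays positive even if \<open>V\<close> is zero.\<close>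
  define V where "V = B * measure lborel (cball (0::'a) (R + 1))"
  have V: "0 \<le> V" unfolding V_def using B_nonneg by simp
  define e' where "e' = e / (V + 1)"
  have e': "0 < e'" "e' * V < e"
    using \<open>0 < e\<close> V by (auto simp: e'_def field_simps)
  obtain d where d: "0 < d" "\<And>x y. norm (x - y) < d \<Longrightarrow> \<bar>r x - r y\<bar> < e'"
    using Cc_uniformly_continuous[OF assms e'(1)] by blast
  have "dist (conv v r y) (conv v r x) < e" if "dist y x < min d 1" for y
  proof -
    define h where "h = y - x"
    \<comment> \<open>A translated kernel minus the kernel itself, so that \<open>conv v s x\<close>
      is the increment of the convolution. The difference is written as a sum with factor
      \<open>- 1\<close> to match \<open>conv_add\<close> and \<open>conv_cmult\<close>.\<close>
    define s where "s z = r (z + h) + (- 1) * r z" for z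
    have s: "Cc s" unfolding s_def by (intro Cc_add Cc_translate Cc_cmult assms)
    have "conv v s x = conv v r (x + h) + (- 1) * conv v r x"
      unfolding s_def
      by (simp only: conv_add conv_translate conv_cmult Cc_translate Cc_cmult assms)
    then have "conv v s x = conv v r y - conv v r x"
      by (simp add: h_def)
    moreover have "\<bar>conv v s x\<bar> \<le> e' * V"
      unfolding V_def
    proof (rule conv_small[OF s])
      show "\<bar>s z\<bar> \<le> e'" for z
        using d(2)[of "z + h" z] that by (simp add: s_def h_def dist_norm less_imp_le)
      show "s z = 0" if "R + 1 < norm z" for z
      proof -
        have "norm h < 1"
          using \<open>dist y x < min d 1\<close> by (simp add: h_def dist_norm)
        then have "R < norm (z + h)"
          using that norm_triangle_ineq2[of z "- h"] by simp
        then show ?thesis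
          using that R by (simp add: s_def)
      qed
    qed (use e' in simp)
    ultimately show ?thesis
      using e' by (simp add: dist_real_def)
  qed
  then show "\<exists>d>0. \<forall>y\<in>UNIV. dist y x < d \<longrightarrow> dist (conv v r y) (conv v r x) < e"
    using d(1) by (intro exI[of _ "min d 1"]) auto
qed

end

section \<open>Differentiating a convolution\<close>

lemma C1c_uniformly_differentiable:
  assumes "C1c r" "0 < e"
  obtains d where "0 < d"
    "\<And>z h. norm h < d \<Longrightarrow> \<bar>r (z + h) - r z - (px r z * fst h + py r z * snd h)\<bar> \<le> e * norm h"
proof -
  have e: "0 < e / 2" using assms(2) by simp
  obtain d1 where d1: "0 < d1" "\<And>x y. norm (x - y) < d1 \<Longrightarrow> \<bar>px r x - px r y\<bar> < e / 2"
    using Cc_uniformly_continuous[OF C1c_Cc(2)[OF assms(1)] e] by blast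
  obtain d2 where d2: "0 < d2" "\<And>x y. norm (x - y) < d2 \<Longrightarrow> \<bar>py r x - py r y\<bar> < e / 2"
    using Cc_uniformly_continuous[OF C1c_Cc(3)[OF assms(1)] e] by blast
  have "\<bar>r (z + h) - r z - (px r z * fst h + py r z * snd h)\<bar> \<le> e * norm h"
    if h: "norm h < min d1 d2" for z h
  proof -
    \<comment> \<open>The derivative of \<open>r\<close> along the segment from \<open>z\<close> to
      \<open>z + h\<close>. The mean value theorem expresses the increment by the partials at an
      intermediate point, which differ from those at \<open>z\<close> by less than
      \<open>e / 2\<close> each.\<close>
    define g' where "g' t = px r (z + t *\<^sub>R h) * fst h + py r (z + t *\<^sub>R h) * snd h" for t
    have "((\<lambda>t. r (z + t *\<^sub>R h)) has_real_derivative g' t) (at t)" for t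
    proof -
      have "((\<lambda>t. z + t *\<^sub>R h) has_derivative (\<lambda>s. s *\<^sub>R h)) (at t)"
        by (auto intro!: derivative_eq_intros)
      from has_derivative_compose[OF this C1_gradD(1)[OF C1c_C1_grad[OF assms(1)]]]
      show ?thesis
        unfolding has_field_derivative_def
        by (rule has_derivative_eq_rhs) (simp add: g'_def fun_eq_iff algebra_simps)
    qed
    then obtain t where t: "0 < t" "t < 1" "r (z + 1 *\<^sub>R h) - r (z + 0 *\<^sub>R h) = (1 - 0) * g' t"
      using MVT2[of 0 1 "\<lambda>t. r (z + t *\<^sub>R h)" g'] by auto
    have "t * norm h \<le> 1 * norm h"
      using t by (intro mult_right_mono) auto
    then have th: "norm ((z + t *\<^sub>R h) - z) < d1" "norm ((z + t *\<^sub>R h) - z) < d2"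
      using h t by auto
    have "r (z + h) - r z - (px r z * fst h + py r z * snd h)
        = (px r (z + t *\<^sub>R h) - px r z) * fst h + (py r (z + t *\<^sub>R h) - py r z) * snd h"
      using t(3) by (simp add: g'_def algebra_simps)
    also have "\<bar>\<dots>\<bar> \<le> \<bar>px r (z + t *\<^sub>R h) - px r z\<bar> * \<bar>fst h\<bar> + \<bar>py r (z + t *\<^sub>R h) - py r z\<bar> * \<bar>snd h\<bar>"
      by (rule abs_triangle_ineq[THEN order_trans]) (simp add: abs_mult)
    also have "\<dots> \<le> (e / 2) * norm h + (e / 2) * norm h"
      using d1(2)[OF th(1)] d2(2)[OF th(2)] norm_fst_le[of "fst h" "snd h"] norm_snd_le[of "snd h" "fst h"] assms(2)
      by (intro add_mono mult_mono) auto
    finally show ?thesis by simp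
  qed
  then show ?thesis
    using d1(1) d2(1) by (intro that[of "min d1 d2"]) auto
qed

text \<open>Convolution is linear in the kernel and commutes with translation, so the remainder of
  \<open>conv v r\<close> at \<open>x\<close> is the convolution of \<open>v\<close> with the Taylor
  remainder of \<open>r\<close>. That remainder is uniformly of size
  \<open>e' * norm h\<close>.\<close>

lemma C1_grad_conv:
  fixes v :: "pt \<Rightarrow> real"
  assumes "bounded_density v B" "C1c r"
  shows "C1_grad (conv v r) (conv v (px r)) (conv v (py r))"
proof -
  interpret bounded_density v B by fact
  note Cc = C1c_Cc[OF assms(2)]
  show ?thesis
  proof (rule C1_gradI)
    fix x :: pt
    obtain R0 R1 R2 where R: "\<And>x. R0 < norm x \<Longrightarrow> r x = 0" "\<And>x. R1 < norm x \<Longrightarrow> px r x = 0"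
      "\<And>x. R2 < norm x \<Longrightarrow> py r x = 0"
      using Cc unfolding Cc_def by metis
    define R where "R = max R0 (max R1 R2)"
    define V where "V = B * measure lborel (cball (0::pt) (R + 1))"
    have V: "0 \<le> V" unfolding V_def using B_nonneg by simp
    let ?D = "\<lambda>h. conv v (px r) x * fst h + conv v (py r) x * snd h"
    show "(conv v r has_derivative ?D) (at x)"
      unfolding has_derivative_at_alt
    proof (intro conjI allI impI)
      show "bounded_linear ?D"
        by (intro bounded_linear_add bounded_linear_const_mult bounded_linear_fst bounded_linear_snd)
      fix e :: real assume "0 < e"
      define e' where "e' = e / (V + 1)"
      have e': "0 < e'" "e' * V \<le> e"
        using \<open>0 < e\<close> V by (auto simp: e'_def field_simps)
      obtain d where d: "0 < d"
        "\<And>z h. norm h < d \<Longrightarrow> \<bar>r (z + h) - r z - (px r z * fst h + py r z * snd h)\<bar> \<le> e' * norm h"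
        using C1c_uniformly_differentiable[OF assms(2) e'(1)] by blast
      have "norm (conv v r y - conv v r x - ?D (y - x)) \<le> e * norm (y - x)"
        if y: "norm (y - x) < min d 1" for y
      proof -
        define h where "h = y - x"
        define s where "s z = r (z + h) + ((- 1) * r z + ((- fst h) * px r z + (- snd h) * py r z))" for z
        have s: "Cc s"
          unfolding s_def by (intro Cc_add Cc_translate Cc_cmult Cc)
        have "conv v s x = conv v r (x + h) + ((- 1) * conv v r x
            + ((- fst h) * conv v (px r) x + (- snd h) * conv v (py r) x))"
          unfolding s_def
          by (simp only: conv_add conv_translate conv_cmult Cc_add Cc_translate Cc_cmult Cc)
        then have eq: "conv v s x = conv v r y - conv v r x - ?D (y - x)"
          by (simp add: h_def algebra_simps)
        have "\<bar>conv v s x\<bar> \<le> (e' * norm h) * V"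
          unfolding V_def
        proof (rule conv_small[OF s])
          show "\<bar>s z\<bar> \<le> e' * norm h" for z
            using d(2)[of h z] y by (simp add: s_def h_def algebra_simps)
          show "s z = 0" if "R + 1 < norm z" for z
          proof -
            have "R < norm (z + h)"
              using that y norm_triangle_ineq2[of z "- h"] unfolding h_def[symmetric] by simp
            then show ?thesis
              using that R by (simp add: s_def R_def)
          qed
        qed (use e' in simp)
        also have "\<dots> = (e' * V) * norm h" by simp
        also have "\<dots> \<le> e * norm h"
          using e'(2) by (rule mult_right_mono) simp
        finally show ?thesis by (simp add: eq h_def)
      qed
      then show "\<exists>d>0. \<forall>y. norm (y - x) < d \<longrightarrow> norm (conv v r y - conv v r x - ?D (y - x)) \<le> e * norm (y - x)"
        using d(1) by (intro exI[of _ "min d 1"]) auto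
    qed
  qed (intro conv_continuous Cc)+
qed

text \<open>The test function is the reflected kernel \<open>r (x - y)\<close> as a function of
  \<open>y\<close>; the minus sign from the chain rule cancels the one in the definition of the
  distributional divergence.\<close>

lemma conv_distr_div:
  assumes "bounded_density v1 B1" "bounded_density v2 B2" "distr_div v1 v2 g" "C1c r"
  shows "conv v1 (px r) x + conv v2 (py r) x = conv g r x"
proof -
  interpret v1: bounded_density v1 B1 by fact
  interpret v2: bounded_density v2 B2 by fact
  note Cc = C1c_Cc[OF assms(4)]
  note reflect = C1c_affine[OF assms(4), of "- 1" x, simplified]
  have "- (\<integral>y. v1 y * px r (x - y) + v2 y * py r (x - y) \<partial>lborel)
      = (\<integral>y. v1 y * (- px r (x - y)) + v2 y * (- py r (x - y)) \<partial>lborel)"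
    by (subst Bochner_Integration.integral_minus[symmetric]) simp
  also have "\<dots> = - (\<integral>y. g y * r (x - y) \<partial>lborel)"
    using assms(3)[unfolded distr_div_def, rule_format, OF reflect(1)] by (simp add: reflect(2,3))
  finally show ?thesis
    unfolding conv_def by (simp add: v1.conv_integrable[OF Cc(2)] v2.conv_integrable[OF Cc(3)])
qed

section \<open>Mollification and the total variation\<close>


lemma DERIV_pos_part_square: "((\<lambda>t::real. (max 0 t)\<^sup>2) has_real_derivative 2 * max 0 x) (at x)"
  unfolding has_field_derivative_def has_derivative_at_alt
proof (intro conjI allI impI)
  show "bounded_linear ((*) (2 * max 0 x))"
    by (rule bounded_linear_mult_right)
  \<comment> \<open>The remainder is at most quadratic. When \<open>x\<close> and \<open>y\<close>
    lie on opposite sides of zero, \<open>x * y \<le> 0\<close> makes \<open>(y - x)\<^sup>2\<close>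
    at least \<open>x\<^sup>2 + y\<^sup>2\<close>.\<close>
  have *: "\<bar>(max 0 y)\<^sup>2 - (max 0 x)\<^sup>2 - 2 * max 0 x * (y - x)\<bar> \<le> (y - x)\<^sup>2" for y
  proof (cases "0 \<le> x"; cases "0 \<le> y")
    assume xy: "0 \<le> x" "\<not> 0 \<le> y"
    then have "x * y \<le> 0" by (simp add: mult_nonneg_nonpos)
    moreover have "(max 0 y)\<^sup>2 - (max 0 x)\<^sup>2 - 2 * max 0 x * (y - x) = x\<^sup>2 - 2 * (x * y)"
      using xy by (simp add: max_def power2_eq_square algebra_simps)
    moreover have "(y - x)\<^sup>2 = x\<^sup>2 - 2 * (x * y) + y\<^sup>2"
      by (simp add: power2_eq_square algebra_simps)
    ultimately show ?thesis
      using zero_le_power2[of x] zero_le_power2[of y] by linarith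
  next
    assume xy: "\<not> 0 \<le> x" "0 \<le> y"
    then have "x * y \<le> 0" by (simp add: mult_nonpos_nonneg)
    moreover have "(max 0 y)\<^sup>2 - (max 0 x)\<^sup>2 - 2 * max 0 x * (y - x) = y\<^sup>2"
      using xy by (simp add: max_def)
    moreover have "(y - x)\<^sup>2 = x\<^sup>2 - 2 * (x * y) + y\<^sup>2"
      by (simp add: power2_eq_square algebra_simps)
    ultimately show ?thesis
      using zero_le_power2[of x] zero_le_power2[of y] by linarith
  qed (use zero_le_power2[of "y - x"] in \<open>auto simp: max_def power2_eq_square algebra_simps\<close>)
  fix e :: real assume "0 < e"
  have "norm ((max 0 y)\<^sup>2 - (max 0 x)\<^sup>2 - 2 * max 0 x * (y - x)) \<le> e * norm (y - x)"
    if "norm (y - x) < e" for y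
  proof -
    have "(y - x)\<^sup>2 = \<bar>y - x\<bar> * \<bar>y - x\<bar>" by (simp add: power2_eq_square)
    also have "\<dots> \<le> e * \<bar>y - x\<bar>" using that by (intro mult_right_mono) auto
    finally show ?thesis using *[of y] by simp
  qed
  then show "\<exists>d>0. \<forall>y. norm (y - x) < d \<longrightarrow>
      norm ((max 0 y)\<^sup>2 - (max 0 x)\<^sup>2 - 2 * max 0 x * (y - x)) \<le> e * norm (y - x)"
    using \<open>0 < e\<close> by blast
qed

text \<open>Squaring the positive part is what makes the profile continuously differentiable across
  the unit circle; test functions here are of class C1, so this regularity suffices.\<close>

definition bump :: "pt \<Rightarrow> real" where
  "bump p = (max 0 (1 - (norm p)\<^sup>2))\<^sup>2"

lemma bump_nonneg: "0 \<le> bump p"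
  by (simp add: bump_def)

lemma bump_le_1: "bump p \<le> 1"
  unfolding bump_def by (intro power_le_one) auto

lemma bump_0: "bump 0 = 1"
  by (simp add: bump_def)

lemma bump_outside: "1 < norm p \<Longrightarrow> bump p = 0"
  by (simp add: bump_def max_def abs_square_le_1 not_le[symmetric])

lemma C1c_bump: "C1c bump"
proof (rule C1cI)
  define q :: "pt \<Rightarrow> real" where "q p = 1 - (fst p)\<^sup>2 - (snd p)\<^sup>2" for p
  have bump_q: "bump = (\<lambda>p. (max 0 (q p))\<^sup>2)"
    by (simp add: fun_eq_iff bump_def q_def norm_prod_def algebra_simps)
  show "C1_grad bump (\<lambda>p. 2 * max 0 (q p) * (- 2 * fst p)) (\<lambda>p. 2 * max 0 (q p) * (- 2 * snd p))"
  proof (rule C1_gradI)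
    fix p
    have q: "(q has_derivative (\<lambda>h. - 2 * fst p * fst h + - 2 * snd p * snd h)) (at p)"
      unfolding q_def[abs_def] by (auto intro!: derivative_eq_intros simp: fun_eq_iff algebra_simps)
    from has_derivative_compose[OF q DERIV_pos_part_square[of "q p", unfolded has_field_derivative_def]]
    show "(bump has_derivative (\<lambda>h. 2 * max 0 (q p) * (- 2 * fst p) * fst h + 2 * max 0 (q p) * (- 2 * snd p) * snd h)) (at p)"
      unfolding bump_q by (rule has_derivative_eq_rhs) (simp add: fun_eq_iff algebra_simps)
  qed (auto simp: q_def intro!: continuous_intros)
  show "bump p = 0" if "1 < norm p" for p
    using that by (rule bump_outside)
qed

text \<open>The dilated bump is normalised by its integral. On the ball of radius
  \<open>d / 2\<close> the profile is at least (1 - 1/4)^2 = 9/16, which makes that integral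
  positive.\<close>

lemma mollifier_exists:
  assumes "0 < d"
  obtains r where "C1c r" "\<And>z. 0 \<le> r z" "(\<integral>z. r z \<partial>lborel) = 1" "\<And>z. d < norm z \<Longrightarrow> r z = 0"
proof -
  define s where "s z = bump (0 + (1 / d) *\<^sub>R z)" for z
  have s: "C1c s"
    unfolding s_def using assms by (intro C1c_affine C1c_bump) auto
  define c where "c = (\<integral>z. s z \<partial>lborel)"
  have ind: "integrable lborel (indicator (cball 0 (d / 2)) :: pt \<Rightarrow> real)"
    by (intro integrable_real_indicator emeasure_bounded_finite) auto
  have "0 < (9 / 16) * measure lborel (cball (0::pt) (d / 2))"
    using assms content_cball_pos[of "d / 2" "0::pt"] by simp
  also have "\<dots> = (\<integral>z. (9 / 16) * indicator (cball (0::pt) (d / 2)) z \<partial>lborel)"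
    by simp
  also have "\<dots> \<le> c"
    unfolding c_def
  proof (rule Bochner_Integration.integral_mono)
    show "(9 / 16) * indicator (cball 0 (d / 2)) z \<le> s z" for z
    proof (cases "norm z \<le> d / 2")
      case True
      then have "(norm ((1 / d) *\<^sub>R z))\<^sup>2 \<le> (1 / 2)\<^sup>2"
        using assms by (intro power_mono) (auto simp: field_simps)
      then have "3 / 4 \<le> max 0 (1 - (norm ((1 / d) *\<^sub>R z))\<^sup>2)"
        unfolding power2_eq_square by (intro max.coboundedI2) (simp add: field_simps)
      then have "(3 / 4)\<^sup>2 \<le> s z"
        unfolding s_def bump_def add_0 by (rule power_mono) simp
      then show ?thesis using True by (simp add: power2_eq_square)
    qed (simp add: s_def bump_nonneg)
  qed (use ind Cc_integrable[OF C1c_Cc(1)[OF s]] in auto)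
  finally have c: "0 < c" .
  show ?thesis
  proof
    show "C1c (\<lambda>z. (1 / c) * s z)" by (rule C1c_cmult(1)[OF s])
    show "0 \<le> (1 / c) * s z" for z using c by (simp add: s_def bump_nonneg)
    show "(\<integral>z. (1 / c) * s z \<partial>lborel) = 1" using c by (simp add: c_def)
    show "(1 / c) * s z = 0" if "d < norm z" for z
      using that assms by (simp add: s_def bump_outside)
  qed
qed

section \<open>Weak convergence of mollifications\<close>

context bounded_density
begin

lemma conv_kernel_bound:
  assumes "Cc r" "\<And>z. 0 \<le> r z" "(\<integral>z. r z \<partial>lborel) = 1"
  shows "\<bar>conv v r x\<bar> \<le> B"
  using conv_bound[OF assms(1), of x] assms(2,3) by simp

text \<open>Fubini moves the convolution from the rough factor \<open>v\<close> to the continuous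
  \<open>u\<close>, at the price of reflecting the kernel.\<close>

lemma integral_conv_swap:
  assumes u: "Cc u" and r: "Cc r"
  shows "(\<integral>x. u x * conv v r x \<partial>lborel) = (\<integral>y. conv u (\<lambda>z. r (- z)) y * v y \<partial>lborel)"
proof -
  \<comment> \<open>The continuous part of the integrand. On its support the first coordinate has
    norm at most \<open>R\<close> and the second at most \<open>R + R'\<close>, so it is integrable
    on the product; the bounded factor \<open>v\<close> is multiplied in afterwards.\<close>
  define H where "H = (\<lambda>p::'a \<times> 'a. u (fst p) * r (fst p - snd p))"
  obtain R R' where R: "\<And>x. R < norm x \<Longrightarrow> u x = 0" "\<And>x. R' < norm x \<Longrightarrow> r x = 0"
    using u r by (auto simp: Cc_def)
  have "continuous_on UNIV H"
    unfolding H_def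
    by (intro continuous_on_mult continuous_on_compose2[OF Cc_continuous[OF u]]
        continuous_on_compose2[OF Cc_continuous[OF r]] continuous_intros) auto
  moreover have "H p = 0" if "R + (R + R') < norm p" for p
  proof (rule ccontr)
    assume "H p \<noteq> 0"
    then have *: "norm (fst p) \<le> R" "norm (fst p - snd p) \<le> R'"
      using R by (force simp: H_def not_less[symmetric])+
    have "norm p \<le> norm (fst p) + norm (snd p)"
      using norm_Pair_le[of "fst p" "snd p"] by simp
    also have "norm (snd p) \<le> norm (fst p) + norm (fst p - snd p)"
      by (metis norm_minus_commute norm_triangle_sub)
    finally show False using * that by simp
  qed
  ultimately have "Cc H" by (auto simp: Cc_def)
  then have int_H: "integrable (lborel \<Otimes>\<^sub>M lborel) H"
    using Cc_integrable by (simp add: lborel_prod)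
  have "AE p in lborel \<Otimes>\<^sub>M lborel. \<bar>v (snd p)\<bar> \<le> B"
  proof (rule lborel_pair.AE_pair_measure)
    show "{p \<in> space (lborel \<Otimes>\<^sub>M lborel). \<bar>v (snd p)\<bar> \<le> B} \<in> sets (lborel \<Otimes>\<^sub>M lborel)"
      by measurable
  qed (use v_bound in simp)
  then have "integrable (lborel \<Otimes>\<^sub>M lborel) (\<lambda>p. H p * v (snd p))"
    by (intro integral_mult_bounded_le(1)[OF int_H]) auto
  then have int: "integrable (lborel \<Otimes>\<^sub>M lborel) (\<lambda>(x, y). u x * r (x - y) * v y)"
    by (simp add: H_def case_prod_beta')
  have "(\<integral>x. u x * conv v r x \<partial>lborel) = (\<integral>x. (\<integral>y. u x * r (x - y) * v y \<partial>lborel) \<partial>lborel)"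
    unfolding conv_def by (simp add: ac_simps flip: Bochner_Integration.integral_mult_right_zero)
  also have "\<dots> = (\<integral>y. (\<integral>x. u x * r (x - y) * v y \<partial>lborel) \<partial>lborel)"
    by (rule lborel_pair.Fubini_integral[OF int, symmetric])
  also have "\<dots> = (\<integral>y. conv u (\<lambda>z. r (- z)) y * v y \<partial>lborel)"
    unfolding conv_def by simp
  finally show ?thesis .
qed

text \<open>For continuous \<open>u\<close> of bounded support the convolution is moved onto
  \<open>u\<close>, where it converges uniformly. Since every mollification is bounded by the same
  \<open>B\<close>, the convergence extends to integrable \<open>u\<close> by density.\<close>

lemma conv_weakly_tendsto:
  assumes r: "\<And>n. Cc (r n)" "\<And>n z. 0 \<le> r n z" "\<And>n. (\<integral>z. r n z \<partial>lborel) = 1"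
    and supp: "\<And>n z. 1 / real (Suc n) < norm z \<Longrightarrow> r n z = 0"
    and u: "integrable lborel u"
  shows "(\<lambda>n. \<integral>x. u x * conv v (r n) x \<partial>lborel) \<longlonglongrightarrow> (\<integral>x. u x * v x \<partial>lborel)"
proof -
  have G: "conv v (r n) \<in> borel_measurable lborel" "AE x in lborel. \<bar>conv v (r n) x\<bar> \<le> B" for n
    using conv_kernel_bound[OF r(1-3)] conv_continuous[OF r(1)]
    by (auto intro: borel_measurable_continuous_onI)
  note boundG = integral_mult_bounded_le[OF _ G]
  have v': "v \<in> borel_measurable lborel" by simp
  note boundv = integral_mult_bounded_le[OF _ v' v_bound]
  show ?thesis
    using u
  proof (induction u rule: integrable_induct_continuous)
    case (cont u R)
    then have u: "Cc u" by (auto simp: Cc_def)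
    obtain Bu where Bu: "\<And>x. \<bar>u x\<bar> \<le> Bu" using Cc_bounded[OF u] by blast
    interpret u: bounded_density u Bu
      by standard (use Bu Cc_borel[OF u] in auto)
    define U where "U n = conv u (\<lambda>z. r n (- z))" for n
    have refl: "Cc (\<lambda>z. r n (- z))" for n
      using Cc_reflect[OF r(1), of n 0] by simp
    have U: "U n \<in> borel_measurable lborel" for n
      unfolding U_def using u.conv_continuous[OF refl] by (simp add: borel_measurable_continuous_onI)
    define V where "V = B * measure lborel (cball (0::'a) (R + 1))"
    have V: "0 \<le> V" unfolding V_def using B_nonneg by simp
    have ind: "integrable lborel (indicator (cball 0 (R + 1)) :: 'a \<Rightarrow> real)"
      by (intro integrable_real_indicator emeasure_bounded_finite) auto
    have Uy: "U n y = (\<integral>x. u x * r n (x - y) \<partial>lborel)" for n y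
      unfolding U_def conv_def by simp
    have shift: "Cc (\<lambda>x. r n (x - y))" "(\<integral>x. r n (x - y) \<partial>lborel) = 1" for n y
      using Cc_translate[OF r(1), of n "- y"] lborel_translate[OF Cc_borel[OF r(1)], of n y] r(3)
      by auto
    \<comment> \<open>All kernels are supported in the unit ball because
      \<open>1 / real (Suc n)\<close> is at most 1, so the support radius \<open>R + 1\<close> is
      uniform in \<open>n\<close>.\<close>
    have U_zero: "U n y = 0" if "R + 1 < norm y" for n y
    proof -
      have "u x * r n (x - y) = 0" for x
      proof (cases "R < norm x")
        case False
        then have "1 < norm (x - y)"
          using that norm_triangle_ineq2[of y x] by (simp add: norm_minus_commute)
        moreover have "1 / real (Suc n) \<le> 1" by simp
        ultimately have "1 / real (Suc n) < norm (x - y)" by linarith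
        then show ?thesis by (simp add: supp)
      qed (simp add: cont(2))
      then show ?thesis by (simp only: Uy Bochner_Integration.integral_zero)
    qed
    have "\<exists>N. \<forall>n\<ge>N. \<bar>(\<integral>x. u x * conv v (r n) x \<partial>lborel) - (\<integral>x. u x * v x \<partial>lborel)\<bar> < e"
      if "0 < e" for e
    proof -
      define e' where "e' = e / (V + 1)"
      have e': "0 < e'" "e' * V < e"
        using \<open>0 < e\<close> V by (auto simp: e'_def field_simps)
      obtain d where d: "0 < d" "\<And>x y. norm (x - y) < d \<Longrightarrow> \<bar>u x - u y\<bar> < e'"
        using Cc_uniformly_continuous[OF u e'(1)] by blast
      obtain N where N: "1 / real (Suc N) < d"
        using d(1) nat_approx_posE by blast
      have "\<bar>(\<integral>x. u x * conv v (r n) x \<partial>lborel) - (\<integral>x. u x * v x \<partial>lborel)\<bar> < e" if "N \<le> n" for n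
      proof -
        have n: "1 / real (Suc n) < d"
          using that N by (intro le_less_trans[OF _ N]) (auto simp: field_simps)
        \<comment> \<open>Since the kernel has integral 1, \<open>u y\<close> is itself an average,
          and the difference averages the oscillation of \<open>u\<close> over distances below
          \<open>d\<close>.\<close>
        have close: "\<bar>U n y - u y\<bar> \<le> e'" for y
        proof -
          have int_ur: "integrable lborel (\<lambda>x. u x * r n (x - y))"
            using Cc_mult[OF shift(1) cont(1)] by (intro Cc_integrable) (simp add: mult.commute)
          have "U n y - u y = (\<integral>x. u x * r n (x - y) \<partial>lborel) - (\<integral>x. u y * r n (x - y) \<partial>lborel)"
            by (simp add: Uy shift)
          also have "\<dots> = (\<integral>x. (u x - u y) * r n (x - y) \<partial>lborel)"
            using int_ur Cc_integrable[OF shift(1)]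
            by (subst Bochner_Integration.integral_diff[symmetric]) (auto simp: left_diff_distrib)
          also have "\<bar>\<dots>\<bar> \<le> (\<integral>x. \<bar>(u x - u y) * r n (x - y)\<bar> \<partial>lborel)"
            by (rule integral_abs_bound)
          also have "\<dots> \<le> (\<integral>x. e' * r n (x - y) \<partial>lborel)"
          proof (rule Bochner_Integration.integral_mono)
            show "\<bar>(u x - u y) * r n (x - y)\<bar> \<le> e' * r n (x - y)" for x
            proof (cases "norm (x - y) < d")
              case True
              then show ?thesis
                using d(2)[OF True] r(2)[of n "x - y"] by (auto simp: abs_mult intro!: mult_right_mono)
            next
              case False
              then show ?thesis using n by (simp add: supp)
            qed
            show "integrable lborel (\<lambda>x. \<bar>(u x - u y) * r n (x - y)\<bar>)"
              using int_ur Cc_integrable[OF shift(1)] by (auto simp: left_diff_distrib)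
          qed (use Cc_integrable[OF shift(1)] in auto)
          finally show ?thesis by (simp add: shift)
        qed
        define D where "D y = U n y - u y" for y
        have D_bound: "\<bar>D y\<bar> \<le> e' * indicator (cball 0 (R + 1)) y" for y
          using close[of y] U_zero[of y n] cont(2)[of y]
          by (cases "R + 1 < norm y") (auto simp: D_def)
        have D_borel: "D \<in> borel_measurable lborel"
          unfolding D_def[abs_def] using U Cc_borel[OF u] by simp
        have D_int: "integrable lborel D"
          by (rule Bochner_Integration.integrable_bound[of _ "\<lambda>y. e' * indicator (cball (0::'a) (R + 1)) y"])
             (use ind D_borel D_bound e'(1) in auto)
        have U_int: "integrable lborel (U n)"
          using Bochner_Integration.integrable_add[OF D_int Cc_integrable[OF u]] by (simp add: D_def)
        have "(\<integral>x. u x * conv v (r n) x \<partial>lborel) - (\<integral>x. u x * v x \<partial>lborel)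
            = (\<integral>y. D y * v y \<partial>lborel)"
          unfolding D_def left_diff_distrib integral_conv_swap[OF u r(1)] U_def[symmetric]
          using boundv(1)[OF U_int] boundv(1)[OF Cc_integrable[OF u]] by simp
        also have "\<bar>\<dots>\<bar> \<le> B * (\<integral>y. \<bar>D y\<bar> \<partial>lborel)"
          by (rule boundv(2)[OF D_int])
        also have "\<dots> \<le> B * (\<integral>y. e' * indicator (cball (0::'a) (R + 1)) y \<partial>lborel)"
          using D_bound D_int ind B_nonneg
          by (intro mult_left_mono Bochner_Integration.integral_mono) auto
        also have "\<dots> = e' * V" by (simp add: V_def)
        finally show ?thesis using e'(2) by linarith
      qed
      then show ?thesis by blast
    qed
    then show ?case by (intro LIMSEQ_I) simp
  next
    case (add f g)
    show ?case
      using tendsto_add[OF add.IH] boundG(1)[OF add.hyps(1)] boundG(1)[OF add.hyps(2)]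
        boundv(1)[OF add.hyps(1)] boundv(1)[OF add.hyps(2)]
      by (simp add: distrib_right)
  next
    case (scale f c)
    show ?case
      using tendsto_mult_left[OF scale.IH, of c] by (simp add: mult.assoc)
  next
    case (lim f s)
    let ?I = "\<lambda>n f. \<integral>x. f x * conv v (r n) x \<partial>lborel" and ?J = "\<lambda>f. \<integral>x. f x * v x \<partial>lborel"
    have "\<exists>N. \<forall>n\<ge>N. norm (?I n f - ?J f) < e" if e: "0 < e" for e
    proof -
      \<comment> \<open>A three-part estimate: replacing \<open>f\<close> by \<open>s i\<close>
        costs less than a third of \<open>e\<close> on either side, for every \<open>n\<close> at
        once because the bound \<open>B\<close> is uniform.\<close>
      define e' where "e' = e / (3 * (B + 1))"
      have e': "0 < e'" "B * e' < e / 3"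
        using e B_nonneg by (auto simp: e'_def field_simps)
      obtain i where i: "(\<integral>x. \<bar>s i x - f x\<bar> \<partial>lborel) < e'"
        using LIMSEQ_D[OF lim.hyps(3) e'(1)] by (auto dest: spec)
      have small: "B * (\<integral>x. \<bar>s i x - f x\<bar> \<partial>lborel) < e / 3"
        using mult_left_mono[OF less_imp_le[OF i] B_nonneg] e'(2) by linarith
      have int: "integrable lborel (\<lambda>x. s i x - f x)" using lim.hyps by simp
      have 1: "\<bar>?I n (s i) - ?I n f\<bar> < e / 3" for n
        using boundG(2)[OF int, of n] boundG(1)[OF lim.hyps(1), of i n] boundG(1)[OF lim.hyps(2), of n] small
        by (simp add: left_diff_distrib)
      have 2: "\<bar>?J (s i) - ?J f\<bar> < e / 3"
        using boundv(2)[OF int] boundv(1)[OF lim.hyps(1), of i] boundv(1)[OF lim.hyps(2)] small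
        by (simp add: left_diff_distrib)
      obtain N where N: "\<And>n. N \<le> n \<Longrightarrow> \<bar>?I n (s i) - ?J (s i)\<bar> < e / 3"
        using LIMSEQ_D[OF lim.IH[of i], of "e / 3"] e by auto
      have "norm (?I n f - ?J f) < e" if "N \<le> n" for n
        using 1[of n] 2 N[OF that] unfolding real_norm_def by linarith
      then show ?thesis by blast
    qed
    then show ?case by (rule LIMSEQ_I)
  qed
qed

end

section \<open>The total variation dominates every admissible pairing\<close>

lemma TV_aniso_upper:
  assumes "C1c v1" "C1c v2" "\<And>p. \<bar>v1 p\<bar> \<le> 1" "\<And>p. \<bar>v2 p\<bar> \<le> 1"
  shows "ereal (\<integral>p. u p * (px v1 p + py v2 p) \<partial>lborel) \<le> TV_aniso u"
  unfolding TV_aniso_def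
  using assms by (intro SUP_upper2[of "(v1, v2)"]) auto

text \<open>Mollification makes \<open>v\<close> smooth and replaces its divergence by a mollified divergence;
  slowly varying cutoffs then give admissible fields in the definition of the total variation.\<close>

lemma TV_aniso_ge_mollified:
  assumes u: "integrable lborel u"
    and v: "bounded_density v1 1" "bounded_density v2 1" "bounded_density g B" "distr_div v1 v2 g"
    and r: "C1c r" "\<And>z. 0 \<le> r z" "(\<integral>z. r z \<partial>lborel) = 1"
  shows "ereal (- (\<integral>p. u p * conv g r p \<partial>lborel)) \<le> TV_aniso u"
proof -
  interpret v1: bounded_density v1 1 by fact
  interpret v2: bounded_density v2 1 by fact
  interpret g: bounded_density g B by fact
  note Cc = C1c_Cc[OF r(1)]
  define W1 W2 G where "W1 = conv v1 r" and "W2 = conv v2 r" and "G = conv g r"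
  have W: "\<bar>W1 p\<bar> \<le> 1" "\<bar>W2 p\<bar> \<le> 1" "\<bar>G p\<bar> \<le> B" for p
    unfolding W1_def W2_def G_def
    using v1.conv_kernel_bound[OF Cc(1) r(2,3)] v2.conv_kernel_bound[OF Cc(1) r(2,3)]
      g.conv_kernel_bound[OF Cc(1) r(2,3)] by auto
  have cont: "continuous_on UNIV W1" "continuous_on UNIV W2" "continuous_on UNIV G"
    unfolding W1_def W2_def G_def
    by (intro v1.conv_continuous v2.conv_continuous g.conv_continuous Cc)+
  note gW1 = C1_grad_conv[OF v(1) r(1), folded W1_def]
  note gW2 = C1_grad_conv[OF v(2) r(1), folded W2_def]
  have div: "conv v1 (px r) p + conv v2 (py r) p = G p" for p
    unfolding G_def by (rule conv_distr_div) fact+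
  define c where "c m = 1 / real (Suc m)" for m
  \<comment> \<open>The bump stretched by the factor \<open>Suc m\<close>: it tends to 1 pointwise
    while its gradient is of order \<open>c m\<close>. The summand \<open>0 +\<close> matches the
    shape of \<open>C1c_affine\<close>.\<close>
  define k where "k m p = bump (0 + c m *\<^sub>R p)" for m p
  have c: "0 < c m" "c m \<le> 1" "c m \<noteq> 0" for m by (auto simp: c_def)
  have c_lim: "c \<longlonglongrightarrow> 0"
    unfolding c_def using LIMSEQ_inverse_real_of_nat by (simp add: inverse_eq_divide)
  note k_affine = C1c_affine[OF C1c_bump c(3), of 0, folded k_def]
  obtain B1 where B1: "\<And>x. \<bar>px bump x\<bar> \<le> B1" using Cc_bounded[OF C1c_Cc(2)[OF C1c_bump]] by blast
  obtain B2 where B2: "\<And>x. \<bar>py bump x\<bar> \<le> B2" using Cc_bounded[OF C1c_Cc(3)[OF C1c_bump]] by blast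
  \<comment> \<open>The error produced by the cutoff: its gradient paired with the mollified field.
    It is bounded by a multiple of \<open>c m\<close>, uniformly in \<open>p\<close>.\<close>
  define E where "E m p = c m * (px bump (0 + c m *\<^sub>R p) * W1 p + py bump (0 + c m *\<^sub>R p) * W2 p)" for m p
  have k01: "0 \<le> k m p" "k m p \<le> 1" for m p
    by (auto simp: k_def bump_nonneg bump_le_1)
  have E_bound: "\<bar>E m p\<bar> \<le> c m * (B1 + B2)" for m p
  proof -
    have "\<bar>px bump (0 + c m *\<^sub>R p) * W1 p\<bar> \<le> B1 * 1" "\<bar>py bump (0 + c m *\<^sub>R p) * W2 p\<bar> \<le> B2 * 1"
      unfolding abs_mult by (intro mult_mono' B1 B2 W abs_ge_zero)+
    then have "\<bar>px bump (0 + c m *\<^sub>R p) * W1 p + py bump (0 + c m *\<^sub>R p) * W2 p\<bar> \<le> B1 + B2"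
      by linarith
    then show ?thesis
      unfolding E_def abs_mult using c(1)[of m] by simp
  qed
  have meas: "k m \<in> borel_measurable borel" "E m \<in> borel_measurable borel" "G \<in> borel_measurable borel" for m
  proof -
    have "continuous_on UNIV (E m)"
      unfolding E_def
      by (intro continuous_intros cont continuous_on_compose2[OF Cc_continuous[OF C1c_Cc(2)[OF C1c_bump]]]
          continuous_on_compose2[OF Cc_continuous[OF C1c_Cc(3)[OF C1c_bump]]]) auto
    then show "k m \<in> borel_measurable borel" "E m \<in> borel_measurable borel" "G \<in> borel_measurable borel"
      using cont Cc_borel[OF C1c_Cc(1)[OF k_affine(1)]] by (auto intro: borel_measurable_continuous_onI)
  qed
  \<comment> \<open>The admissible field is minus the cut-off mollification, since the total
    variation is a supremum over pairings with the divergence itself, without a sign.\<close>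
  have le: "ereal (\<integral>p. u p * - (k m p * G p + E m p) \<partial>lborel) \<le> TV_aniso u" for m
  proof -
    note m1 = C1c_mult[OF k_affine(1)[of m] gW1] and m2 = C1c_mult[OF k_affine(1)[of m] gW2]
    note n1 = C1c_uminus[OF m1(1)] and n2 = C1c_uminus[OF m2(1)]
    have "px (\<lambda>p. - (k m p * W1 p)) p + py (\<lambda>p. - (k m p * W2 p)) p = - (k m p * G p + E m p)" for p
      unfolding n1(2) n2(3) m1(2) m2(3) k_affine div[symmetric] E_def
      by (simp add: algebra_simps)
    moreover have "\<bar>- (k m p * W1 p)\<bar> \<le> 1" "\<bar>- (k m p * W2 p)\<bar> \<le> 1" for p
      using k01[of m p] W[of p] by (auto simp: abs_mult intro: mult_le_one)
    ultimately show ?thesis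
      using TV_aniso_upper[OF n1(1) n2(1), of u] by simp
  qed
  have "(\<lambda>m. \<integral>p. u p * - (k m p * G p + E m p) \<partial>lborel) \<longlonglongrightarrow> (\<integral>p. u p * - (1 * G p + 0) \<partial>lborel)"
  proof (rule integral_dominated_convergence[where w = "\<lambda>p. (B + \<bar>B1 + B2\<bar>) * \<bar>u p\<bar>"])
    show "AE p in lborel. (\<lambda>m. u p * - (k m p * G p + E m p)) \<longlonglongrightarrow> u p * - (1 * G p + 0)"
    proof (rule AE_I2)
      fix p :: pt
      have "(\<lambda>m. 0 + c m *\<^sub>R p) \<longlonglongrightarrow> 0"
        using tendsto_scaleR[OF c_lim tendsto_const[of p]] by simp
      moreover have "isCont bump 0"
        using Cc_continuous[OF C1c_Cc(1)[OF C1c_bump]]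
        unfolding continuous_on_eq_continuous_at[OF open_UNIV] by blast
      ultimately have "(\<lambda>m. k m p) \<longlonglongrightarrow> 1"
        unfolding k_def using isCont_tendsto_compose[of 0 bump] by (simp add: bump_0)
      moreover have "(\<lambda>m. E m p) \<longlonglongrightarrow> 0"
      proof (rule Lim_null_comparison)
        show "\<forall>\<^sub>F m in sequentially. norm (E m p) \<le> c m * (B1 + B2)"
          using E_bound by simp
        show "(\<lambda>m. c m * (B1 + B2)) \<longlonglongrightarrow> 0"
          by (rule tendsto_mult_left_zero[OF c_lim])
      qed
      ultimately show "(\<lambda>m. u p * - (k m p * G p + E m p)) \<longlonglongrightarrow> u p * - (1 * G p + 0)"
        by (intro tendsto_intros)
    qed
    show "AE p in lborel. norm (u p * - (k m p * G p + E m p)) \<le> (B + \<bar>B1 + B2\<bar>) * \<bar>u p\<bar>" for m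
    proof (rule AE_I2)
      fix p :: pt
      have "\<bar>k m p * G p\<bar> \<le> 1 * B"
        unfolding abs_mult using k01[of m p] W[of p] by (intro mult_mono) auto
      moreover have "c m * (B1 + B2) \<le> c m * \<bar>B1 + B2\<bar>" "c m * \<bar>B1 + B2\<bar> \<le> 1 * \<bar>B1 + B2\<bar>"
        using c[of m] by (intro mult_left_mono mult_right_mono; simp)+
      ultimately have "\<bar>k m p * G p + E m p\<bar> \<le> B + \<bar>B1 + B2\<bar>"
        using order_trans[OF abs_triangle_ineq[of "k m p * G p" "E m p"] add_mono] E_bound[of m p]
        by (metis mult_1 order_trans)
      then show "norm (u p * - (k m p * G p + E m p)) \<le> (B + \<bar>B1 + B2\<bar>) * \<bar>u p\<bar>"
        by (simp add: abs_mult mult.commute mult_left_mono del: minus_add_distrib)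
    qed
  qed (use u meas in \<open>auto simp del: minus_add_distrib\<close>)
  then have "(\<lambda>m. ereal (\<integral>p. u p * - (k m p * G p + E m p) \<partial>lborel)) \<longlonglongrightarrow> ereal (- (\<integral>p. u p * G p \<partial>lborel))"
    by simp
  then show ?thesis
    unfolding G_def by (rule LIMSEQ_le_const2) (use le[unfolded G_def] in blast)
qed

theorem TV_aniso_ge_pairing:
  assumes u: "integrable lborel u"
    and v: "Linf v1" "Linf v2" "AE p in lborel. \<bar>v1 p\<bar> \<le> 1 \<and> \<bar>v2 p\<bar> \<le> 1" "Linf g" "distr_div v1 v2 g"
  shows "ereal (- (\<integral>p. u p * g p \<partial>lborel)) \<le> TV_aniso u"
proof -
  obtain B where "AE p in lborel. \<bar>g p\<bar> \<le> B" using v(4) by (auto simp: Linf_def)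
  then have dens: "bounded_density v1 1" "bounded_density v2 1" "bounded_density g B"
    using v by (auto simp: bounded_density_def Linf_def elim: eventually_mono)
  have "\<exists>r. C1c r \<and> (\<forall>z. 0 \<le> r z) \<and> (\<integral>z. r z \<partial>lborel) = 1 \<and> (\<forall>z. 1 / real (Suc n) < norm z \<longrightarrow> r z = 0)" for n
    using mollifier_exists[of "1 / real (Suc n)"] by (metis divide_pos_pos of_nat_0_less_iff zero_less_Suc zero_less_one)
  then obtain r where r: "\<And>n. C1c (r n)" "\<And>n z. 0 \<le> r n z" "\<And>n. (\<integral>z. r n z \<partial>lborel) = 1"
    "\<And>n z. 1 / real (Suc n) < norm z \<Longrightarrow> r n z = 0"
    by metis
  have "(\<lambda>n. \<integral>x. u x * conv g (r n) x \<partial>lborel) \<longlonglongrightarrow> (\<integral>x. u x * g x \<partial>lborel)"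
    by (rule bounded_density.conv_weakly_tendsto[OF dens(3) C1c_Cc(1)[OF r(1)] r(2-4) u])
  then have "(\<lambda>n. ereal (- (\<integral>x. u x * conv g (r n) x \<partial>lborel))) \<longlonglongrightarrow> ereal (- (\<integral>x. u x * g x \<partial>lborel))"
    by (simp add: tendsto_minus)
  then show ?thesis
    by (rule LIMSEQ_le_const2)
       (use TV_aniso_ge_mollified[OF u dens v(5) r(1-3)] in blast)
qed

section \<open>Functions of bounded variation\<close>


text \<open>Integration by parts moves the derivatives onto \<open>f\<close>, and each component of
  the field is at most 1 in absolute value. The Euclidean unit ball lies in the maximum-norm ball,
  so the same estimate serves \<open>TV_iso\<close>. The first bound controls \<open>F3\<close> at a
  test function; the second makes test functions competitors in \<open>BV\<close>.\<close>

lemma TV_aniso_C1c_le: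
  assumes "C1c f"
  shows "TV_aniso f \<le> ereal ((\<integral>p. \<bar>px f p\<bar> \<partial>lborel) + (\<integral>p. \<bar>py f p\<bar> \<partial>lborel))"
    and "TV_iso f \<le> ereal ((\<integral>p. \<bar>px f p\<bar> \<partial>lborel) + (\<integral>p. \<bar>py f p\<bar> \<partial>lborel))"
proof -
  note int = C1c_Cc(2,3)[OF assms, THEN Cc_integrable]
  have *: "(\<integral>p. f p * (px v1 p + py v2 p) \<partial>lborel) \<le> (\<integral>p. \<bar>px f p\<bar> \<partial>lborel) + (\<integral>p. \<bar>py f p\<bar> \<partial>lborel)"
    if v: "C1c v1" "C1c v2" and v_le: "\<And>p. \<bar>v1 p\<bar> \<le> 1" "\<And>p. \<bar>v2 p\<bar> \<le> 1" for v1 v2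
  proof -
    have m: "v1 \<in> borel_measurable lborel" "v2 \<in> borel_measurable lborel"
      using v[THEN C1c_Cc(1), THEN Cc_borel] by auto
    have ae: "AE p in lborel. \<bar>v1 p\<bar> \<le> 1" "AE p in lborel. \<bar>v2 p\<bar> \<le> 1"
      using v_le by auto
    show ?thesis
      using integral_mult_bounded_le[OF int(1) m(1) ae(1)] integral_mult_bounded_le[OF int(2) m(2) ae(2)]
      unfolding C1c_integral_by_parts[OF assms v] by simp
  qed
  show "TV_aniso f \<le> ereal ((\<integral>p. \<bar>px f p\<bar> \<partial>lborel) + (\<integral>p. \<bar>py f p\<bar> \<partial>lborel))"
    unfolding TV_aniso_def by (rule SUP_least) (auto intro!: *)
  have unit: "\<bar>a\<bar> \<le> 1 \<and> \<bar>b\<bar> \<le> 1" if "a\<^sup>2 + b\<^sup>2 \<le> 1" for a b :: real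
  proof -
    have "a\<^sup>2 \<le> 1" "b\<^sup>2 \<le> 1" using that zero_le_power2[of a] zero_le_power2[of b] by linarith+
    then show ?thesis by (simp add: abs_square_le_1)
  qed
  show "TV_iso f \<le> ereal ((\<integral>p. \<bar>px f p\<bar> \<partial>lborel) + (\<integral>p. \<bar>py f p\<bar> \<partial>lborel))"
    unfolding TV_iso_def
  proof (rule SUP_least, clarify)
    fix v1 v2 :: "pt \<Rightarrow> real"
    assume v: "C1c v1" "C1c v2" "\<forall>p. (v1 p)\<^sup>2 + (v2 p)\<^sup>2 \<le> 1"
    then have "\<bar>v1 p\<bar> \<le> 1" "\<bar>v2 p\<bar> \<le> 1" for p
      using unit by blast+
    with v(1,2) show "ereal (\<integral>p. f p * (px (fst (v1, v2)) p + py (snd (v1, v2)) p) \<partial>lborel)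
        \<le> ereal ((\<integral>p. \<bar>px f p\<bar> \<partial>lborel) + (\<integral>p. \<bar>py f p\<bar> \<partial>lborel))"
      by (auto intro!: *)
  qed
qed

lemma BV_C1c:
  assumes "C1c f"
  shows "BV f"
proof -
  have "TV_iso f < \<infinity>"
    by (rule le_less_trans[OF TV_aniso_C1c_le(2)[OF assms]]) simp
  then show ?thesis
    using Cc_integrable[OF C1c_Cc(1)[OF assms]] by (simp add: BV_def)
qed

lemma integrable_mult_div:
  assumes "integrable lborel u" "C1c v1" "C1c v2"
  shows "integrable lborel (\<lambda>p. u p * (px v1 p + py v2 p))"
proof -
  have div: "Cc (\<lambda>p. px v1 p + py v2 p)"
    using assms by (intro Cc_add C1c_Cc)
  obtain B where "\<And>x. \<bar>px v1 x + py v2 x\<bar> \<le> B"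
    using Cc_bounded[OF div] by blast
  then show ?thesis
    using Cc_borel[OF div] by (intro integral_mult_bounded_le(1)[OF assms(1), where B = B]) auto
qed

text \<open>Negating an admissible field keeps it admissible, which absorbs the minus sign.
  Differences matter because the certificate is applied to \<open>u - u0\<close>.\<close>

lemma BV_diff:
  assumes "BV u" "BV w"
  shows "BV (\<lambda>p. u p - w p)"
proof -
  have int: "integrable lborel u" "integrable lborel w"
    using assms by (auto simp: BV_def)
  have "TV_iso (\<lambda>p. u p - w p) \<le> TV_iso u + TV_iso w"
    unfolding TV_iso_def[of "\<lambda>p. u p - w p"]
  proof (rule SUP_least, clarify)
    fix v1 v2 :: "pt \<Rightarrow> real"
    assume v: "C1c v1" "C1c v2" "\<forall>p. (v1 p)\<^sup>2 + (v2 p)\<^sup>2 \<le> 1"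
    note neg1 = C1c_uminus[OF v(1)] and neg2 = C1c_uminus[OF v(2)]
    have "(\<integral>p. (u p - w p) * (px v1 p + py v2 p) \<partial>lborel)
        = (\<integral>p. u p * (px v1 p + py v2 p) \<partial>lborel)
          + (\<integral>p. w p * (px (\<lambda>p. - v1 p) p + py (\<lambda>p. - v2 p) p) \<partial>lborel)"
      unfolding Bochner_Integration.integral_add[OF integrable_mult_div[OF int(1) v(1,2)]
          integrable_mult_div[OF int(2) neg1(1) neg2(1)], symmetric]
      by (rule Bochner_Integration.integral_cong) (simp_all add: neg1(2) neg2(3) algebra_simps)
    moreover have "ereal (\<integral>p. u p * (px v1 p + py v2 p) \<partial>lborel) \<le> TV_iso u"
      unfolding TV_iso_def using v by (intro SUP_upper2[of "(v1, v2)"]) auto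
    moreover have "ereal (\<integral>p. w p * (px (\<lambda>p. - v1 p) p + py (\<lambda>p. - v2 p) p) \<partial>lborel) \<le> TV_iso w"
      unfolding TV_iso_def using v neg1(1) neg2(1)
      by (intro SUP_upper2[of "(\<lambda>p. - v1 p, \<lambda>p. - v2 p)"]) auto
    ultimately show "ereal (\<integral>p. (u p - w p) * (px (fst (v1, v2)) p + py (snd (v1, v2)) p) \<partial>lborel) \<le> TV_iso u + TV_iso w"
      using add_mono[of "ereal _" "TV_iso u" "ereal _" "TV_iso w"] by simp
  qed
  also have "\<dots> < \<infinity>"
    using assms by (auto simp: BV_def)
  finally show ?thesis
    using int by (simp add: BV_def)
qed

lemma C1c_zero: "C1c (\<lambda>p. 0)" "px (\<lambda>p. 0) = (\<lambda>p. 0)" "py (\<lambda>p. 0) = (\<lambda>p. 0)"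
  using C1c_cmult[OF C1c_bump, of 0] by simp_all

lemma TV_aniso_nonneg: "0 \<le> TV_aniso u"
  using TV_aniso_upper[OF C1c_zero(1) C1c_zero(1), of u] by (simp add: C1c_zero zero_ereal_def)

text \<open>Integrable functions as a vector-space type, so that the Hahn-Banach argument applies.
  Functions equal almost everywhere are not identified: the functionals involved are sublinear on
  functions as they stand.\<close>

typedef L1 = "{u :: pt \<Rightarrow> real. integrable lborel u}"
  morphisms fun_of L1
  by (intro exI[of _ "\<lambda>p. 0"]) simp

setup_lifting type_definition_L1

instantiation L1 :: real_vector
begin

lift_definition zero_L1 :: L1 is "\<lambda>p. 0" by simp
lift_definition plus_L1 :: "L1 \<Rightarrow> L1 \<Rightarrow> L1" is "\<lambda>u v p. u p + v p" by simp
lift_definition minus_L1 :: "L1 \<Rightarrow> L1 \<Rightarrow> L1" is "\<lambda>u v p. u p - v p" by simp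
lift_definition uminus_L1 :: "L1 \<Rightarrow> L1" is "\<lambda>u p. - u p" by simp
lift_definition scaleR_L1 :: "real \<Rightarrow> L1 \<Rightarrow> L1" is "\<lambda>c u p. c * u p" by simp

instance
  by standard (transfer; simp add: fun_eq_iff algebra_simps)+

end

lemma integrable_fun_of: "integrable lborel (fun_of a)"
  using fun_of[of a] by simp

lemma fun_of_L1: "integrable lborel u \<Longrightarrow> fun_of (L1 u) = u"
  by (simp add: L1_inverse)

lemma L1_add: "integrable lborel u \<Longrightarrow> integrable lborel v \<Longrightarrow> L1 (\<lambda>p. u p + v p) = L1 u + L1 v"
  by (simp add: fun_of_L1 plus_L1_def fun_of_inverse)

lemma L1_scale: "integrable lborel u \<Longrightarrow> L1 (\<lambda>p. c * u p) = c *\<^sub>R L1 u"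
  by (simp add: fun_of_L1 scaleR_L1_def)

text \<open>The one-sided bound becomes two-sided when it is applied to the negative of a function,
  which places \<open>L\<close> in the setting of the representation theorem.\<close>

lemma L1_dual_representation:
  fixes L :: "L1 \<Rightarrow> real"
  assumes L: "linear L" and bound: "\<And>a. L a \<le> B * (\<integral>p. \<bar>fun_of a p\<bar> \<partial>lborel)"
  obtains g where "g \<in> borel_measurable lborel" "AE p in lborel. \<bar>g p\<bar> \<le> B"
    "\<And>u. integrable lborel u \<Longrightarrow> L (L1 u) = (\<integral>p. u p * g p \<partial>lborel)"
proof -
  interpret bounded_L1_functional lborel "\<lambda>u. L (L1 u)" B
  proof
    fix u :: "pt \<Rightarrow> real" assume u: "integrable lborel u"
    have "- L (L1 u) = L (L1 (\<lambda>p. (- 1) * u p))"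
      using L1_scale[OF u, of "- 1"] linear_neg[OF L, of "L1 u"] by simp
    then show "\<bar>L (L1 u)\<bar> \<le> B * (\<integral>p. \<bar>u p\<bar> \<partial>lborel)"
      using bound[of "L1 u"] bound[of "L1 (\<lambda>p. (- 1) * u p)"] u by (simp add: fun_of_L1)
  qed (simp_all add: L1_add L1_scale linear_add[OF L] linear_scale[OF L])
  show ?thesis
    using representation[OF lborel.sigma_finite_measure_axioms] that by blast
qed

section \<open>Optimality\<close>


text \<open>Linearity holds almost everywhere only, so the operator is handled through integrals of
  its absolute value, which do not see null sets.\<close>

locale L1_operator =
  fixes K :: "(pt \<Rightarrow> real) \<Rightarrow> (pt \<Rightarrow> real)"
  assumes K_int: "integrable lborel u \<Longrightarrow> integrable lborel (K u)"
    and K_lin: "integrable lborel u \<Longrightarrow> integrable lborel v \<Longrightarrow>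
        AE p in lborel. K (\<lambda>x. a * u x + b * v x) p = a * K u p + b * K v p"
begin

lemma K_norm_comb:
  assumes "integrable lborel u" "integrable lborel v"
  shows "(\<integral>p. \<bar>K (\<lambda>x. a * u x + b * v x) p\<bar> \<partial>lborel) = (\<integral>p. \<bar>a * K u p + b * K v p\<bar> \<partial>lborel)"
proof (rule integral_cong_AE)
  have "integrable lborel (K (\<lambda>x. a * u x + b * v x))"
    using assms by (intro K_int) auto
  then show "(\<lambda>p. \<bar>K (\<lambda>x. a * u x + b * v x) p\<bar>) \<in> borel_measurable lborel"
    by measurable
  show "(\<lambda>p. \<bar>a * K u p + b * K v p\<bar>) \<in> borel_measurable lborel"
    using K_int[OF assms(1)] K_int[OF assms(2)] by measurable
  show "AE p in lborel. \<bar>K (\<lambda>x. a * u x + b * v x) p\<bar> = \<bar>a * K u p + b * K v p\<bar>"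
    using K_lin[OF assms, of a b] by eventually_elim simp
qed

lemma K_norm_add:
  assumes "integrable lborel u" "integrable lborel v"
  shows "(\<integral>p. \<bar>K (\<lambda>x. u x + v x) p\<bar> \<partial>lborel) \<le> (\<integral>p. \<bar>K u p\<bar> \<partial>lborel) + (\<integral>p. \<bar>K v p\<bar> \<partial>lborel)"
proof -
  note Kuv = K_int[OF assms(1)] K_int[OF assms(2)]
  have "(\<integral>p. \<bar>K (\<lambda>x. u x + v x) p\<bar> \<partial>lborel) = (\<integral>p. \<bar>K u p + K v p\<bar> \<partial>lborel)"
    using K_norm_comb[OF assms, of 1 1] by simp
  also have "\<dots> \<le> (\<integral>p. \<bar>K u p\<bar> + \<bar>K v p\<bar> \<partial>lborel)"
    using Kuv by (intro Bochner_Integration.integral_mono) (auto intro: abs_triangle_ineq)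
  finally show ?thesis using Kuv by simp
qed

lemma K_norm_diff:
  assumes "integrable lborel u" "integrable lborel v"
  shows "(\<integral>p. \<bar>K (\<lambda>x. u x - v x) p\<bar> \<partial>lborel) = (\<integral>p. \<bar>K u p - K v p\<bar> \<partial>lborel)"
  using K_norm_comb[OF assms, of 1 "- 1"] by simp

lemma K_norm_scale:
  assumes "integrable lborel u"
  shows "(\<integral>p. \<bar>K (\<lambda>x. c * u x) p\<bar> \<partial>lborel) = \<bar>c\<bar> * (\<integral>p. \<bar>K u p\<bar> \<partial>lborel)"
  using K_norm_comb[OF assms assms, of c 0] by (simp add: abs_mult)

lemma sublinear_K_norm: "sublinear (\<lambda>a. \<integral>p. \<bar>K (fun_of a) p\<bar> \<partial>lborel)"
proof (rule sublinearI)
  show "(\<integral>p. \<bar>K (fun_of (a + b)) p\<bar> \<partial>lborel)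
      \<le> (\<integral>p. \<bar>K (fun_of a) p\<bar> \<partial>lborel) + (\<integral>p. \<bar>K (fun_of b) p\<bar> \<partial>lborel)" for a b
    using K_norm_add[OF integrable_fun_of integrable_fun_of, of a b] by (simp add: plus_L1.rep_eq)
  show "(\<integral>p. \<bar>K (fun_of (c *\<^sub>R a)) p\<bar> \<partial>lborel) \<le> c * (\<integral>p. \<bar>K (fun_of a) p\<bar> \<partial>lborel)" if "0 < c" for c a
    using K_norm_scale[OF integrable_fun_of, of c a] that by (simp add: scaleR_L1.rep_eq)
  show "(\<integral>p. \<bar>K (fun_of 0) p\<bar> \<partial>lborel) = 0"
    using K_norm_scale[of "\<lambda>p. 0" 0] by (simp add: zero_L1.rep_eq)
qed

lemma F3_diff:
  assumes "integrable lborel u" "integrable lborel u0"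
  shows "F3 lam K (K u0) u = TV_aniso u + ereal (lam * (\<integral>p. \<bar>K (\<lambda>x. u x - u0 x) p\<bar> \<partial>lborel))"
  using assms by (simp add: F3_def K_norm_diff)

text \<open>The fidelity term vanishes at \<open>u0\<close>, and the pairing bounds the total
  variation of \<open>u\<close> from below. The pairing is split at \<open>u0\<close> so that the
  inequality for the certificate can be used with \<open>w = u - u0\<close>.\<close>

lemma F3_certificate:
  assumes "inV u0 v1 v2 g" "BV u0" "BV u"
  shows "F3 lam K (K u0) u0 = ereal (- (\<integral>p. u0 p * g p \<partial>lborel))"
    and "ereal (- (\<integral>p. u0 p * g p \<partial>lborel) - (\<integral>p. (u p - u0 p) * g p \<partial>lborel)
      + lam * (\<integral>p. \<bar>K (\<lambda>x. u x - u0 x) p\<bar> \<partial>lborel)) \<le> F3 lam K (K u0) u"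
proof -
  have int: "integrable lborel u0" "integrable lborel u"
    using assms(2,3) by (auto simp: BV_def)
  show "F3 lam K (K u0) u0 = ereal (- (\<integral>p. u0 p * g p \<partial>lborel))"
    using assms(1) by (simp add: F3_def inV_def)
  obtain B where B: "AE p in lborel. \<bar>g p\<bar> \<le> B" and g: "g \<in> borel_measurable lborel"
    using assms(1) by (auto simp: inV_def Linf_def)
  have "- (\<integral>p. u0 p * g p \<partial>lborel) - (\<integral>p. (u p - u0 p) * g p \<partial>lborel) = - (\<integral>p. u p * g p \<partial>lborel)"
    using integral_mult_bounded_le(1)[OF int(1) g B] integral_mult_bounded_le(1)[OF int(2) g B]
    by (simp add: left_diff_distrib)
  moreover have "ereal (- (\<integral>p. u p * g p \<partial>lborel)) \<le> TV_aniso u"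
    using assms(1) by (intro TV_aniso_ge_pairing[OF int(2), of v1 v2]) (auto simp: inV_def)
  ultimately show "ereal (- (\<integral>p. u0 p * g p \<partial>lborel) - (\<integral>p. (u p - u0 p) * g p \<partial>lborel)
      + lam * (\<integral>p. \<bar>K (\<lambda>x. u x - u0 x) p\<bar> \<partial>lborel)) \<le> F3 lam K (K u0) u"
    unfolding F3_diff[OF int(2,1)] plus_ereal.simps(1)[symmetric] by (intro add_right_mono) simp
qed

lemma minimizer_if_certificate:
  assumes V: "inV u0 v1 v2 g" and u0: "BV u0"
    and le: "\<And>w. BV w \<Longrightarrow> \<bar>\<integral>p. w p * g p \<partial>lborel\<bar> \<le> lam * (\<integral>p. \<bar>K w p\<bar> \<partial>lborel)"
  shows "is_minimizer_F3 lam K (K u0) u0"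
  unfolding is_minimizer_F3_def
proof (intro conjI allI impI)
  fix u assume u: "BV u"
  have "ereal (- (\<integral>p. u0 p * g p \<partial>lborel)) \<le> ereal (- (\<integral>p. u0 p * g p \<partial>lborel)
      - (\<integral>p. (u p - u0 p) * g p \<partial>lborel) + lam * (\<integral>p. \<bar>K (\<lambda>x. u x - u0 x) p\<bar> \<partial>lborel))"
    using le[OF BV_diff[OF u u0]] by simp
  also have "\<dots> \<le> F3 lam K (K u0) u"
    by (rule F3_certificate(2)[OF V u0 u])
  finally show "F3 lam K (K u0) u0 \<le> F3 lam K (K u0) u"
    by (simp only: F3_certificate(1)[OF V u0 u])
qed (fact u0)

text \<open>For \<open>w\<close> vanishing almost everywhere the pairing is zero, so strictness
  elsewhere still gives the weak inequality for all \<open>w\<close>. Strictness at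
  \<open>u - u0\<close> puts the value of any essentially different \<open>u\<close> above that of
  \<open>u0\<close>.\<close>

lemma unique_minimizer_if_strict_certificate:
  assumes V: "inV u0 v1 v2 g" and u0: "BV u0"
    and less: "\<And>w. BV w \<Longrightarrow> \<not> (AE p in lborel. w p = 0) \<Longrightarrow>
      \<bar>\<integral>p. w p * g p \<partial>lborel\<bar> < lam * (\<integral>p. \<bar>K w p\<bar> \<partial>lborel)"
    and lam: "0 \<le> lam"
  shows "is_unique_minimizer_F3 lam K (K u0) u0"
  unfolding is_unique_minimizer_F3_def
proof (intro conjI allI impI)
  show "is_minimizer_F3 lam K (K u0) u0"
  proof (rule minimizer_if_certificate[OF V u0])
    fix w assume w: "BV w"
    show "\<bar>\<integral>p. w p * g p \<partial>lborel\<bar> \<le> lam * (\<integral>p. \<bar>K w p\<bar> \<partial>lborel)"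
    proof (cases "AE p in lborel. w p = 0")
      case True
      then have "(\<integral>p. w p * g p \<partial>lborel) = 0"
        by (intro integral_eq_zero_AE) (auto elim: eventually_mono)
      then show ?thesis using lam by simp
    qed (simp add: less w less_imp_le)
  qed
next
  fix u assume min: "is_minimizer_F3 lam K (K u0) u"
  then have u: "BV u" by (simp add: is_minimizer_F3_def)
  show "AE p in lborel. u p = u0 p"
  proof (rule ccontr)
    assume "\<not> (AE p in lborel. u p = u0 p)"
    then have "\<not> (AE p in lborel. u p - u0 p = 0)" by simp
    from less[OF BV_diff[OF u u0] this]
    have "ereal (- (\<integral>p. u0 p * g p \<partial>lborel)) < ereal (- (\<integral>p. u0 p * g p \<partial>lborel)
        - (\<integral>p. (u p - u0 p) * g p \<partial>lborel) + lam * (\<integral>p. \<bar>K (\<lambda>x. u x - u0 x) p\<bar> \<partial>lborel))"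
      by simp
    also have "\<dots> \<le> F3 lam K (K u0) u"
      by (rule F3_certificate(2)[OF V u0 u])
    finally have "F3 lam K (K u0) u0 < F3 lam K (K u0) u"
      by (simp only: F3_certificate(1)[OF V u0 u])
    moreover have "F3 lam K (K u0) u \<le> F3 lam K (K u0) u0"
      using min u0 by (simp add: is_minimizer_F3_def)
    ultimately show False by simp
  qed
qed

lemma certificate_if_minimizer:
  assumes min: "is_minimizer_F3 lam K (K u0) u0" and lam: "0 \<le> lam"
    and bdd: "\<And>u. integrable lborel u \<Longrightarrow> (\<integral>p. \<bar>K u p\<bar> \<partial>lborel) \<le> C * (\<integral>p. \<bar>u p\<bar> \<partial>lborel)"
  obtains v1 v2 g where "inV u0 v1 v2 g"
    "\<And>w. BV w \<Longrightarrow> \<bar>\<integral>p. w p * g p \<partial>lborel\<bar> \<le> lam * (\<integral>p. \<bar>K w p\<bar> \<partial>lborel)"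
proof -
  let ?n = "\<lambda>a. \<integral>p. \<bar>fun_of a p\<bar> \<partial>lborel" and ?k = "\<lambda>a. \<integral>p. \<bar>K (fun_of a) p\<bar> \<partial>lborel"
  \<comment> \<open>The L1 norm is the case of the identity operator, so its sublinearity is an
    instance of the lemma about \<open>K\<close>.\<close>
  interpret id: L1_operator "\<lambda>u. u" by standard auto
  have n: "sublinear ?n" by (rule id.sublinear_K_norm)
  have k: "sublinear ?k" by (rule sublinear_K_norm)
  have int0: "integrable lborel u0"
    using min by (simp add: is_minimizer_F3_def BV_def)
  have F3_u0: "F3 lam K (K u0) u0 = TV_aniso u0" by (simp add: F3_def)
  have TV_le: "TV_aniso u0 \<le> ereal ((\<integral>p. \<bar>px f p\<bar> \<partial>lborel) + (\<integral>p. \<bar>py f p\<bar> \<partial>lborel)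
      + lam * (\<integral>p. \<bar>K (\<lambda>x. f x - u0 x) p\<bar> \<partial>lborel))" if f: "C1c f" for f
  proof -
    have "TV_aniso u0 \<le> F3 lam K (K u0) f"
      using min BV_C1c[OF f] F3_u0 by (simp add: is_minimizer_F3_def)
    also have "\<dots> \<le> ereal ((\<integral>p. \<bar>px f p\<bar> \<partial>lborel) + (\<integral>p. \<bar>py f p\<bar> \<partial>lborel))
        + ereal (lam * (\<integral>p. \<bar>K (\<lambda>x. f x - u0 x) p\<bar> \<partial>lborel))"
      unfolding F3_diff[OF Cc_integrable[OF C1c_Cc(1)[OF f]] int0]
      by (intro add_right_mono TV_aniso_C1c_le(1) f)
    finally show ?thesis by simp
  qed
  \<comment> \<open>Comparing \<open>u0\<close> with the zero function shows that its anisotropic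
    variation is finite.\<close>
  obtain T where T: "TV_aniso u0 = ereal T" "0 \<le> T"
    using TV_le[OF C1c_zero(1)] TV_aniso_nonneg[of u0] by (cases "TV_aniso u0") auto
  define p :: "L1 \<times> L1 \<times> L1 \<Rightarrow> real" where "p = (\<lambda>(a, b, c). ?n a + ?n b + lam * ?k c)"
  have p_nonneg: "0 \<le> p x" for x
    using lam by (auto simp: p_def split: prod.split intro!: add_nonneg_nonneg mult_nonneg_nonneg)
  have p_sub: "sublinear p"
  proof (rule sublinearI)
    show "p (x + y) \<le> p x + p y" for x y
    proof -
      obtain a b c a' b' c' where xy: "x = (a, b, c)" "y = (a', b', c')" by (metis prod.collapse)
      have "lam * ?k (c + c') \<le> lam * (?k c + ?k c')"
        using lam by (intro mult_left_mono sublinear_add[OF k])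
      then show ?thesis
        using sublinear_add[OF n, of a a'] sublinear_add[OF n, of b b']
        unfolding xy p_def by (simp add: distrib_left)
    qed
    show "p (t *\<^sub>R x) \<le> t * p x" if "0 < t" for t x
    proof -
      obtain a b c where x: "x = (a, b, c)" by (metis prod.collapse)
      show ?thesis
        using that sublinear_scale[OF n, of t a] sublinear_scale[OF n, of t b] sublinear_scale[OF k, of t c]
        unfolding x p_def by (simp add: algebra_simps)
    qed
    show "p 0 = 0"
      using sublinear_zero[OF n] sublinear_zero[OF k] by (simp add: p_def zero_prod_def)
  qed
  \<comment> \<open>The value is \<open>- t * T\<close> because \<open>inV\<close> asks for minus
    the pairing with \<open>u0\<close> to equal the total variation.\<close>
  define E :: "(pt \<Rightarrow> real) \<Rightarrow> real \<Rightarrow> (L1 \<times> L1 \<times> L1) \<times> real" where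
    "E f t = ((L1 (px f), L1 (py f), L1 f + t *\<^sub>R L1 u0), - t * T)" for f t
  \<comment> \<open>\<open>S\<close> is closed under negation, so domination on \<open>S\<close> fixes the values of the functional there.\<close>
  define S where "S = {E f t | f t. C1c f}"
  have E_add: "E f t + E g s = E (\<lambda>p. f p + g p) (t + s)" if f: "C1c f" and g: "C1c g" for f g t s
    unfolding E_def C1c_add(2,3)[OF f g]
    by (simp add: L1_add C1c_Cc f g Cc_integrable algebra_simps)
  have E_scale: "c *\<^sub>R E f t = E (\<lambda>p. c * f p) (c * t)" if f: "C1c f" for f t c
    unfolding E_def C1c_cmult(2,3)[OF f]
    by (simp add: L1_scale C1c_Cc f Cc_integrable algebra_simps)
  obtain L where L: "linear L" "\<And>x. L x \<le> p x" "\<And>m c. (m, c) \<in> S \<Longrightarrow> c \<le> L m"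
  proof (rule Mazur_Orlicz_cone[OF p_sub, of S])
    show "0 \<in> S"
      using E_scale[OF C1c_zero(1), of 0 0] C1c_zero(1) unfolding S_def by (auto intro!: exI[of _ "\<lambda>p. 0"] exI[of _ 0])
    show "x + y \<in> S" if "x \<in> S" "y \<in> S" for x y
      using that E_add C1c_add(1) unfolding S_def by blast
    show "c *\<^sub>R x \<in> S" if "x \<in> S" for c x
      using that E_scale C1c_cmult(1) unfolding S_def by blast
    fix m c assume "(m, c) \<in> S"
    then obtain f t where f: "C1c f" and mc: "(m, c) = E f t" unfolding S_def by blast
    \<comment> \<open>For nonnegative \<open>t\<close> the prescribed value is at most zero and
      \<open>p\<close> is nonnegative. For negative \<open>t\<close>, dividing by
      \<open>s = - t\<close> leaves the minimality inequality for the competitor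
      \<open>f / s\<close>.\<close>
    show "c \<le> p m"
    proof (cases "0 \<le> t")
      case True
      then have "c \<le> 0" using mc T(2) by (simp add: E_def)
      then show ?thesis using p_nonneg order_trans by blast
    next
      case False
      define s where "s = - t"
      have s: "0 < s" using False by (simp add: s_def)
      note h = C1c_cmult[OF f, of "1 / s"]
      note intf = C1c_Cc[OF f, THEN Cc_integrable]
      have "fun_of (L1 f + t *\<^sub>R L1 u0) = (\<lambda>x. s * ((1 / s) * f x - u0 x))"
        using s intf int0 by (simp add: plus_L1.rep_eq scaleR_L1.rep_eq fun_of_L1 s_def fun_eq_iff algebra_simps)
      then have kc: "?k (L1 f + t *\<^sub>R L1 u0) = s * (\<integral>p. \<bar>K (\<lambda>x. (1 / s) * f x - u0 x) p\<bar> \<partial>lborel)"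
        using s intf int0 K_norm_scale[of "\<lambda>x. (1 / s) * f x - u0 x" s] by simp
      have "T \<le> (\<integral>p. \<bar>(1 / s) * px f p\<bar> \<partial>lborel) + (\<integral>p. \<bar>(1 / s) * py f p\<bar> \<partial>lborel)
          + lam * (\<integral>p. \<bar>K (\<lambda>x. (1 / s) * f x - u0 x) p\<bar> \<partial>lborel)"
        using TV_le[OF h(1)] unfolding T(1) h(2,3) by simp
      then have "s * T \<le> s * ((\<integral>p. \<bar>(1 / s) * px f p\<bar> \<partial>lborel) + (\<integral>p. \<bar>(1 / s) * py f p\<bar> \<partial>lborel)
          + lam * (\<integral>p. \<bar>K (\<lambda>x. (1 / s) * f x - u0 x) p\<bar> \<partial>lborel))"
        using s by (intro mult_left_mono) auto
      also have "\<dots> = p m"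
        using mc s kc intf by (simp add: E_def p_def fun_of_L1 abs_mult algebra_simps)
      finally show ?thesis
        using mc by (simp add: E_def s_def)
    qed
  qed (rule that)
  \<comment> \<open>Both \<open>E f t\<close> and its negative belong to \<open>S\<close>, so the
    lower bound on \<open>S\<close> holds with equality.\<close>
  have L_E: "L (fst (E f t)) = - t * T" if f: "C1c f" for f t
  proof -
    have "E f t \<in> S" "(- 1) *\<^sub>R E f t \<in> S"
      using f E_scale[OF f, of "- 1" t] C1c_cmult(1)[OF f, of "- 1"] unfolding S_def by auto
    then have "snd (E f t) \<le> L (fst (E f t))" "snd (- E f t) \<le> L (fst (- E f t))"
      using L(3) by (metis prod.collapse scaleR_minus1_left)+
    then show ?thesis
      using linear_neg[OF L(1), of "fst (E f t)"] by (simp add: E_def)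
  qed
  note n0 = sublinear_zero[OF n] and k0 = sublinear_zero[OF k]
  have L_scale: "r * L x = L (r *\<^sub>R x)" for r x
    by (simp add: linear_scale[OF L(1)])
  have lin: "linear (\<lambda>a. L (a, 0, 0))" "linear (\<lambda>a. L (0, a, 0))" "linear (\<lambda>a. L (0, 0, a))"
    by (auto intro!: linearI simp: linear_add[OF L(1), symmetric] L_scale)
  have split: "L (a, b, c) = L (a, 0, 0) + L (0, b, 0) + L (0, 0, c)" for a b c
    by (simp add: linear_add[OF L(1), symmetric])
  \<comment> \<open>With the other two arguments zero, \<open>p\<close> is the plain L1 norm, which
    gives the bound 1.\<close>
  obtain v1 where v1: "v1 \<in> borel_measurable lborel" "AE p in lborel. \<bar>v1 p\<bar> \<le> 1"
    "\<And>u. integrable lborel u \<Longrightarrow> L (L1 u, 0, 0) = (\<integral>p. u p * v1 p \<partial>lborel)"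
    using L1_dual_representation[OF lin(1), of 1] L(2)[of "(_, 0, 0)"] n0 k0 by (auto simp: p_def)
  obtain v2 where v2: "v2 \<in> borel_measurable lborel" "AE p in lborel. \<bar>v2 p\<bar> \<le> 1"
    "\<And>u. integrable lborel u \<Longrightarrow> L (0, L1 u, 0) = (\<integral>p. u p * v2 p \<partial>lborel)"
    using L1_dual_representation[OF lin(2), of 1] L(2)[of "(0, _, 0)"] n0 k0 by (auto simp: p_def)
  have Lk: "L (0, 0, a) \<le> lam * ?k a" for a
    using L(2)[of "(0, 0, a)"] n0 by (simp add: p_def)
  \<comment> \<open>Boundedness of \<open>K\<close> gives an L1 bound and hence a representing
    function in L^inf. The sharper \<open>Lk\<close> is kept for the final inequality.\<close>
  have "L (0, 0, a) \<le> (lam * C) * ?n a" for a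
    using Lk[of a] mult_left_mono[OF bdd[OF integrable_fun_of[of a]] lam] by (simp add: mult.assoc)
  then obtain g where g: "g \<in> borel_measurable lborel" "AE p in lborel. \<bar>g p\<bar> \<le> lam * C"
    "\<And>u. integrable lborel u \<Longrightarrow> L (0, 0, L1 u) = (\<integral>p. u p * g p \<partial>lborel)"
    using L1_dual_representation[OF lin(3), of "lam * C"] by blast
  show ?thesis
  proof
    have "distr_div v1 v2 g"
      unfolding distr_div_def
    proof (intro allI impI)
      fix f assume f: "C1c f"
      note intf = C1c_Cc[OF f, THEN Cc_integrable]
      have "L (L1 (px f), L1 (py f), L1 f) = 0"
        using L_E[OF f, of 0] by (simp add: E_def)
      then have "(\<integral>p. px f p * v1 p \<partial>lborel) + (\<integral>p. py f p * v2 p \<partial>lborel) + (\<integral>p. f p * g p \<partial>lborel) = 0"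
        using split[of "L1 (px f)" "L1 (py f)" "L1 f"] intf by (simp add: v1(3) v2(3) g(3))
      moreover have "integrable lborel (\<lambda>p. px f p * v1 p)" "integrable lborel (\<lambda>p. py f p * v2 p)"
        using integral_mult_bounded_le(1)[OF intf(2) v1(1,2)] integral_mult_bounded_le(1)[OF intf(3) v2(1,2)] by auto
      ultimately show "(\<integral>p. v1 p * px f p + v2 p * py f p \<partial>lborel) = - (\<integral>p. g p * f p \<partial>lborel)"
        by (simp add: mult.commute)
    qed
    moreover have "- (\<integral>p. u0 p * g p \<partial>lborel) = T"
    proof -
      have "L1 (\<lambda>p. 0) = 0" by (simp add: zero_L1_def)
      then have "L (0, 0, L1 u0) = - T"
        using L_E[OF C1c_zero(1), of 1] by (simp add: E_def C1c_zero)
      then show ?thesis by (simp add: g(3) int0)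
    qed
    ultimately show "inV u0 v1 v2 g"
      using v1(1,2) v2(1,2) g(1,2) T(1) by (auto simp: inV_def Linf_def)
    fix w assume "BV w"
    then have w: "integrable lborel w" by (simp add: BV_def)
    have "(\<integral>p. w p * g p \<partial>lborel) \<le> lam * (\<integral>p. \<bar>K w p\<bar> \<partial>lborel)"
      using Lk[of "L1 w"] w by (simp add: g(3) fun_of_L1)
    \<comment> \<open>The same bound at \<open>- w\<close>; the integral of \<open>|K w|\<close> is
      unchanged under the sign, which gives the absolute value.\<close>
    moreover have "- (\<integral>p. w p * g p \<partial>lborel) \<le> lam * (\<integral>p. \<bar>K w p\<bar> \<partial>lborel)"
      using Lk[of "L1 (\<lambda>p. (- 1) * w p)"] K_norm_scale[OF w, of "- 1"] w
        g(3)[of "\<lambda>p. - w p"] by (simp add: fun_of_L1)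
    ultimately show "\<bar>\<integral>p. w p * g p \<partial>lborel\<bar> \<le> lam * (\<integral>p. \<bar>K w p\<bar> \<partial>lborel)"
      by (simp add: abs_le_iff)
  qed
qed

end

theorem mainTheorem11:
  fixes K :: "(pt \<Rightarrow> real) \<Rightarrow> (pt \<Rightarrow> real)" and lam :: real and u0 f :: "pt \<Rightarrow> real"
  assumes K_int: "\<And>u. integrable lborel u \<Longrightarrow> integrable lborel (K u)"
    and K_lin: "\<And>u v a b. integrable lborel u \<Longrightarrow> integrable lborel v \<Longrightarrow>
        AE p in lborel. K (\<lambda>x. a * u x + b * v x) p = a * K u p + b * K v p"
    and K_bdd: "\<exists>C. \<forall>u. integrable lborel u \<longrightarrow>
        (\<integral>p. \<bar>K u p\<bar> \<partial>lborel) \<le> C * (\<integral>p. \<bar>u p\<bar> \<partial>lborel)"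
    and K_pos: "\<And>u. integrable lborel u \<Longrightarrow> (AE p in lborel. u p \<ge> 0) \<Longrightarrow>
        AE p in lborel. K u p \<ge> 0"
    and K_mass: "\<And>u. integrable lborel u \<Longrightarrow>
        (\<integral>p. K u p \<partial>lborel) = (\<integral>p. u p \<partial>lborel)"
    and lam: "lam \<ge> 0"
    and u0: "BV u0"
    and f: "f = K u0"
  shows "(is_minimizer_F3 lam K f u0 \<longleftrightarrow>
           (\<exists>v1 v2 g. inV u0 v1 v2 g \<and>
              (\<forall>w. BV w \<longrightarrow> \<bar>\<integral>p. w p * g p \<partial>lborel\<bar> \<le> lam * (\<integral>p. \<bar>K w p\<bar> \<partial>lborel))))
       \<and> ((\<exists>v1 v2 g. inV u0 v1 v2 g \<and>
              (\<forall>w. BV w \<longrightarrow> \<not> (AE p in lborel. w p = 0) \<longrightarrow>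
                 \<bar>\<integral>p. w p * g p \<partial>lborel\<bar> < lam * (\<integral>p. \<bar>K w p\<bar> \<partial>lborel)))
          \<longrightarrow> is_unique_minimizer_F3 lam K f u0)"
proof -
  interpret L1_operator K
    by standard (fact K_int K_lin)+
  obtain C where C: "\<And>u. integrable lborel u \<Longrightarrow>
      (\<integral>p. \<bar>K u p\<bar> \<partial>lborel) \<le> C * (\<integral>p. \<bar>u p\<bar> \<partial>lborel)"
    using K_bdd by blast
  show ?thesis
    unfolding f
    using certificate_if_minimizer[OF _ lam C] minimizer_if_certificate[OF _ u0]
      unique_minimizer_if_strict_certificate[OF _ u0 _ lam]
    by (intro conjI iffI impI) (metis, blast, blast)
qed

end
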